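(* Let $(M,\omega)$ be a noncompact connected symplectic manifold and let $\mathfrak b\subset C^\infty(M)$ be a finite-dimensional basic algebra of observables on $M$. Then $\mathfrak b$ has no faithful finite-dimensional representations by symmetric operators; that is, there is no finite-dimensional complex Hilbert space $\mathcal H$ and injective real-linear map $\varrho$ from $\mathfrak b$ to the symmetric (Hermitian) operators on $\mathcal H$ with $\varrho(\{f,g\})=\frac{i}{\hbar}[\varrho(f),\varrho(g)]$ for all $f,g\in\mathfrak b$.
   Context: $C^\infty(M)$ denotes the real-valued smooth functions on $M$ with the Poisson bracket $\{\cdot,\cdot\}$ of $\omega$; $X_f$ is the Hamiltonian vector field of $f$; $\hbar>0$ is a fixed constant. A basic algebra of observables is a Lie subalgebra $\mathfrak b\subset C^\infty(M)$ such that: (B1) $\mathfrak b$ is finitely generated as a Lie algebra; (B2) for every $f\in\mathfrak b$ the Hamiltonian vector field $X_f$ is complete; (B3) $\mathfrak b$ is transitive, i.e. $\{X_f(m)\mid f\in\mathfrak b\}$ spans $T_mM$ for every $m\in M$, and separating, i.e. for $m\neq m'$ in $M$ there is $f\in\mathfrak b$ with $f(m)\ne f(m')$; (B4) $\mathfrak b$ is minimal with these properties, i.e. no proper Lie subalgebra of $\mathfrak b$ satisfies (B1)-(B3). *)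

theory Defs
  imports "HOL-Analysis.Analysis" "HOL-Library.Function_Algebras"
begin

text \<open>Real vector space structure on functions (pointwise), so that \<open>subspace\<close> and \<open>span\<close>
  apply to spaces of real functions and to tangent vectors.\<close>

instantiation "fun" :: (type, scaleR) scaleR
begin

definition scaleR_fun :: "real \<Rightarrow> ('a \<Rightarrow> 'b) \<Rightarrow> 'a \<Rightarrow> 'b"
  where "scaleR_fun r f = (\<lambda>x. r *\<^sub>R f x)"

instance ..

end

instance "fun" :: (type, real_vector) real_vector
  by standard (auto simp: scaleR_fun_def fun_eq_iff scaleR_add_right scaleR_add_left)


section \<open>Smooth manifolds\<close>

text \<open>The next two notions are only meant for open \<open>S\<close>.\<close>

fun Ck_on :: "nat \<Rightarrow> ('a::real_normed_vector \<Rightarrow> 'b::real_normed_vector) \<Rightarrow> 'a set \<Rightarrow> bool" where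
  "Ck_on 0 f S \<longleftrightarrow> continuous_on S f"
| "Ck_on (Suc k) f S \<longleftrightarrow> (\<forall>x\<in>S. f differentiable (at x)) \<and>
     (\<forall>v. Ck_on k (\<lambda>x. frechet_derivative f (at x) v) S)"

definition smooth_on :: "('a::real_normed_vector \<Rightarrow> 'b::real_normed_vector) \<Rightarrow> 'a set \<Rightarrow> bool"
  where "smooth_on f S \<longleftrightarrow> (\<forall>k. Ck_on k f S)"

text \<open>A manifold is a Hausdorff second countable type \<open>'m\<close> with an atlas. A chart consists of its
  domain and its coordinate map, whose values outside the domain play no role.\<close>

type_synonym ('m, 'e) chart = "'m set \<times> ('m \<Rightarrow> 'e)"

definition chart_inv :: "('m, 'e) chart \<Rightarrow> 'e \<Rightarrow> 'm"
  where "chart_inv c = inv_into (fst c) (snd c)"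

definition transition :: "('m, 'e) chart \<Rightarrow> ('m, 'e) chart \<Rightarrow> 'e \<Rightarrow> 'e"
  where "transition c c' = snd c' \<circ> chart_inv c"

definition smooth_atlas ::
  "('m::{t2_space,second_countable_topology}, 'e::euclidean_space) chart set \<Rightarrow> bool"
  where "smooth_atlas A \<longleftrightarrow>
    (\<Union>c\<in>A. fst c) = UNIV \<and>
    (\<forall>c\<in>A. open (fst c) \<and> open (snd c ` fst c) \<and>
       homeomorphism (fst c) (snd c ` fst c) (snd c) (chart_inv c)) \<and>
    (\<forall>c\<in>A. \<forall>c'\<in>A. smooth_on (transition c c') (snd c ` (fst c \<inter> fst c')))"

definition smooth_functions :: "('m, 'e::euclidean_space) chart set \<Rightarrow> ('m \<Rightarrow> real) set"
  where "smooth_functions A = {f. \<forall>c\<in>A. smooth_on (f \<circ> chart_inv c) (snd c ` fst c)}"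

definition charts_at :: "('m, 'e) chart set \<Rightarrow> 'm \<Rightarrow> ('m, 'e) chart set"
  where "charts_at A m = {c\<in>A. m \<in> fst c}"

text \<open>A tangent vector at \<open>m\<close> is given by its components in all charts around \<open>m\<close>, related to each
  other by the derivatives of the transition maps. The component is set to 0 for anything that is
  not a chart around \<open>m\<close>, so that vectors with the same components are equal.\<close>

type_synonym ('m, 'e) tangent = "('m, 'e) chart \<Rightarrow> 'e"

definition tangent_space ::
  "('m, 'e::euclidean_space) chart set \<Rightarrow> 'm \<Rightarrow> ('m, 'e) tangent set"
  where "tangent_space A m = {v.
    (\<forall>c. c \<notin> charts_at A m \<longrightarrow> v c = 0) \<and>
    (\<forall>c\<in>charts_at A m. \<forall>c'\<in>charts_at A m.
       v c' = frechet_derivative (transition c c') (at (snd c m)) (v c))}"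

text \<open>The tangent vector at \<open>m\<close> with component \<open>u\<close> in the chart \<open>c\<close> around \<open>m\<close>; for a basis vector
  \<open>u\<close> this is the coordinate vector field of \<open>c\<close> in direction \<open>u\<close>.\<close>

definition coord_vector ::
  "('m, 'e::euclidean_space) chart set \<Rightarrow> ('m, 'e) chart \<Rightarrow> 'e \<Rightarrow> 'm \<Rightarrow> ('m, 'e) tangent"
  where "coord_vector A c u m = (\<lambda>c'. if c' \<in> charts_at A m
    then frechet_derivative (transition c c') (at (snd c m)) u else 0)"

text \<open>The value does not depend on the choice of the chart (chain rule).\<close>

definition differential ::
  "('m, 'e::euclidean_space) chart set \<Rightarrow> ('m \<Rightarrow> real) \<Rightarrow> 'm \<Rightarrow> ('m, 'e) tangent \<Rightarrow> real"
  where "differential A f m v = (let c = (SOME c. c \<in> charts_at A m) in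
    frechet_derivative (f \<circ> chart_inv c) (at (snd c m)) (v c))"

definition integral_curve ::
  "('m::topological_space, 'e::euclidean_space) chart set \<Rightarrow> ('m \<Rightarrow> ('m, 'e) tangent) \<Rightarrow>
     (real \<Rightarrow> 'm) \<Rightarrow> bool"
  where "integral_curve A X \<gamma> \<longleftrightarrow> continuous_on UNIV \<gamma> \<and>
    (\<forall>t. \<forall>c\<in>charts_at A (\<gamma> t). ((snd c \<circ> \<gamma>) has_vector_derivative X (\<gamma> t) c) (at t))"

definition complete_vector_field ::
  "('m::topological_space, 'e::euclidean_space) chart set \<Rightarrow> ('m \<Rightarrow> ('m, 'e) tangent) \<Rightarrow> bool"
  where "complete_vector_field A X \<longleftrightarrow> (\<forall>m. \<exists>\<gamma>. \<gamma> 0 = m \<and> integral_curve A X \<gamma>)"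


section \<open>Symplectic manifolds\<close>

type_synonym ('m, 'e) two_tensor = "'m \<Rightarrow> ('m, 'e) tangent \<Rightarrow> ('m, 'e) tangent \<Rightarrow> real"

definition coefficient ::
  "('m, 'e::euclidean_space) chart set \<Rightarrow> ('m, 'e) two_tensor \<Rightarrow> ('m, 'e) chart \<Rightarrow>
     'e \<Rightarrow> 'e \<Rightarrow> 'e \<Rightarrow> real"
  where "coefficient A \<omega> c u v x = (let m = chart_inv c x in
    \<omega> m (coord_vector A c u m) (coord_vector A c v m))"

definition two_form :: "('m, 'e::euclidean_space) chart set \<Rightarrow> ('m, 'e) two_tensor \<Rightarrow> bool"
  where "two_form A \<omega> \<longleftrightarrow>
    (\<forall>m. \<forall>u\<in>tangent_space A m. \<forall>v\<in>tangent_space A m. \<forall>w\<in>tangent_space A m. \<forall>r.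
       \<omega> m (u + v) w = \<omega> m u w + \<omega> m v w \<and>
       \<omega> m (r *\<^sub>R u) w = r * \<omega> m u w \<and>
       \<omega> m u w = - \<omega> m w u) \<and>
    (\<forall>c\<in>A. \<forall>u v. smooth_on (coefficient A \<omega> c u v) (snd c ` fst c))"

text \<open>The exterior derivative, evaluated on constant vectors \<open>u\<close>, \<open>v\<close>, \<open>w\<close> of a chart (whose
  commutators vanish), is the cyclic sum below.\<close>

definition closed_form :: "('m, 'e::euclidean_space) chart set \<Rightarrow> ('m, 'e) two_tensor \<Rightarrow> bool"
  where "closed_form A \<omega> \<longleftrightarrow>
    (\<forall>c\<in>A. \<forall>x\<in>snd c ` fst c. \<forall>u v w.
       frechet_derivative (coefficient A \<omega> c v w) (at x) u +
       frechet_derivative (coefficient A \<omega> c w u) (at x) v +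
       frechet_derivative (coefficient A \<omega> c u v) (at x) w = 0)"

definition nondegenerate :: "('m, 'e::euclidean_space) chart set \<Rightarrow> ('m, 'e) two_tensor \<Rightarrow> bool"
  where "nondegenerate A \<omega> \<longleftrightarrow>
    (\<forall>m. \<forall>v\<in>tangent_space A m. (\<forall>w\<in>tangent_space A m. \<omega> m v w = 0) \<longrightarrow> v = 0)"

definition symplectic_manifold ::
  "('m::{t2_space,second_countable_topology}, 'e::euclidean_space) chart set \<Rightarrow>
     ('m, 'e) two_tensor \<Rightarrow> bool"
  where "symplectic_manifold A \<omega> \<longleftrightarrow>
    smooth_atlas A \<and> two_form A \<omega> \<and> closed_form A \<omega> \<and> nondegenerate A \<omega>"

text \<open>Sign conventions: \<open>\<omega>(X\<^sub>f, \<cdot>) = df\<close> and \<open>{f,g} = X\<^sub>f g\<close>, so that \<open>{p,q} = 1\<close> for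
  \<open>\<omega> = dq \<and> dp\<close>. The opposite sign of the bracket is obtained by passing from \<open>\<omega>\<close> to \<open>-\<omega>\<close>.\<close>

definition hamiltonian_vf ::
  "('m, 'e::euclidean_space) chart set \<Rightarrow> ('m, 'e) two_tensor \<Rightarrow> ('m \<Rightarrow> real) \<Rightarrow>
     'm \<Rightarrow> ('m, 'e) tangent"
  where "hamiltonian_vf A \<omega> f m =
    (THE v. v \<in> tangent_space A m \<and> (\<forall>w\<in>tangent_space A m. \<omega> m v w = differential A f m w))"

definition poisson_bracket ::
  "('m, 'e::euclidean_space) chart set \<Rightarrow> ('m, 'e) two_tensor \<Rightarrow>
     ('m \<Rightarrow> real) \<Rightarrow> ('m \<Rightarrow> real) \<Rightarrow> 'm \<Rightarrow> real"
  where "poisson_bracket A \<omega> f g m = differential A g m (hamiltonian_vf A \<omega> f m)"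


section \<open>Basic algebras of observables\<close>

definition lie_subalgebra ::
  "('m, 'e::euclidean_space) chart set \<Rightarrow> ('m, 'e) two_tensor \<Rightarrow> ('m \<Rightarrow> real) set \<Rightarrow> bool"
  where "lie_subalgebra A \<omega> b \<longleftrightarrow> b \<subseteq> smooth_functions A \<and> subspace b \<and>
    (\<forall>f\<in>b. \<forall>g\<in>b. poisson_bracket A \<omega> f g \<in> b)"

definition finitely_generated ::
  "('m, 'e::euclidean_space) chart set \<Rightarrow> ('m, 'e) two_tensor \<Rightarrow> ('m \<Rightarrow> real) set \<Rightarrow> bool"
  where "finitely_generated A \<omega> b \<longleftrightarrow> (\<exists>F\<subseteq>b. finite F \<and> lie_subalgebra A \<omega> hull F = b)"

definition complete_fields ::
  "('m::topological_space, 'e::euclidean_space) chart set \<Rightarrow> ('m, 'e) two_tensor \<Rightarrow>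
     ('m \<Rightarrow> real) set \<Rightarrow> bool"
  where "complete_fields A \<omega> b \<longleftrightarrow> (\<forall>f\<in>b. complete_vector_field A (hamiltonian_vf A \<omega> f))"

definition transitive ::
  "('m, 'e::euclidean_space) chart set \<Rightarrow> ('m, 'e) two_tensor \<Rightarrow> ('m \<Rightarrow> real) set \<Rightarrow> bool"
  where "transitive A \<omega> b \<longleftrightarrow>
    (\<forall>m. span ((\<lambda>f. hamiltonian_vf A \<omega> f m) ` b) = tangent_space A m)"

definition separating :: "('m \<Rightarrow> real) set \<Rightarrow> bool"
  where "separating b \<longleftrightarrow> (\<forall>m m'. m \<noteq> m' \<longrightarrow> (\<exists>f\<in>b. f m \<noteq> f m'))"

definition observables_B1_B3 ::
  "('m::topological_space, 'e::euclidean_space) chart set \<Rightarrow> ('m, 'e) two_tensor \<Rightarrow>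
     ('m \<Rightarrow> real) set \<Rightarrow> bool"
  where "observables_B1_B3 A \<omega> b \<longleftrightarrow> lie_subalgebra A \<omega> b \<and>
    finitely_generated A \<omega> b \<and> complete_fields A \<omega> b \<and> transitive A \<omega> b \<and> separating b"

definition basic_algebra ::
  "('m::topological_space, 'e::euclidean_space) chart set \<Rightarrow> ('m, 'e) two_tensor \<Rightarrow>
     ('m \<Rightarrow> real) set \<Rightarrow> bool"
  where "basic_algebra A \<omega> b \<longleftrightarrow> observables_B1_B3 A \<omega> b \<and>
    (\<forall>b'. b' \<subset> b \<longrightarrow> \<not> observables_B1_B3 A \<omega> b')"

definition finite_dimensional :: "'v::real_vector set \<Rightarrow> bool"
  where "finite_dimensional V \<longleftrightarrow> (\<exists>B. finite B \<and> span B = V)"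


section \<open>Representations by symmetric operators\<close>

text \<open>Completeness is automatic in finite dimension. The zero space is included.\<close>

locale finite_dim_complex_hilbert = vector_space cscale
  for cscale :: "complex \<Rightarrow> 'h::ab_group_add \<Rightarrow> 'h" +
  fixes ip :: "'h \<Rightarrow> 'h \<Rightarrow> complex"
  assumes ip_add: "ip x (y + z) = ip x y + ip x z"
    and ip_scale: "ip x (cscale a y) = a * ip x y"
    and ip_commute: "ip y x = cnj (ip x y)"
    and ip_positive: "x \<noteq> 0 \<Longrightarrow> Re (ip x x) > 0"
    and finite_dim: "\<exists>B. finite B \<and> module.span cscale B = UNIV"

definition symmetric_operator ::
  "(complex \<Rightarrow> 'h::ab_group_add \<Rightarrow> 'h) \<Rightarrow> ('h \<Rightarrow> 'h \<Rightarrow> complex) \<Rightarrow> ('h \<Rightarrow> 'h) \<Rightarrow> bool"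
  where "symmetric_operator cscale ip T \<longleftrightarrow>
    Vector_Spaces.linear cscale cscale T \<and> (\<forall>x y. ip (T x) y = ip x (T y))"

definition faithful_symmetric_representation ::
  "('m, 'e::euclidean_space) chart set \<Rightarrow> ('m, 'e) two_tensor \<Rightarrow> real \<Rightarrow> ('m \<Rightarrow> real) set \<Rightarrow>
     (complex \<Rightarrow> 'h::ab_group_add \<Rightarrow> 'h) \<Rightarrow> ('h \<Rightarrow> 'h \<Rightarrow> complex) \<Rightarrow>
     (('m \<Rightarrow> real) \<Rightarrow> 'h \<Rightarrow> 'h) \<Rightarrow> bool"
  where "faithful_symmetric_representation A \<omega> hbar b cscale ip \<rho> \<longleftrightarrow>
    (\<forall>f\<in>b. symmetric_operator cscale ip (\<rho> f)) \<and>
    (\<forall>f\<in>b. \<forall>g\<in>b. \<forall>x. \<rho> (f + g) x = \<rho> f x + \<rho> g x) \<and>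
    (\<forall>f\<in>b. \<forall>r x. \<rho> (r *\<^sub>R f) x = cscale (complex_of_real r) (\<rho> f x)) \<and>
    inj_on \<rho> b \<and>
    (\<forall>f\<in>b. \<forall>g\<in>b. \<forall>x. \<rho> (poisson_bracket A \<omega> f g) x =
       cscale (\<i> / complex_of_real hbar) (\<rho> f (\<rho> g x) - \<rho> g (\<rho> f x)))"

end

theory Submission
  imports Defs "HOL-Computational_Algebra.Fundamental_Theorem_Algebra"
begin

text \<open>Given a faithful representation \<open>\<rho>\<close>, the trace form \<open>tr (\<rho> f \<circ> \<rho> g)\<close> is an invariant inner product
  on \<open>b\<close>, through which a point \<open>m\<close> becomes a Hermitian operator \<open>H m = (\<Sum>e\<in>E. e(m) \<rho> e)\<close>, with \<open>E\<close> an
  orthonormal basis of \<open>b\<close>. The Hamiltonian flows conjugate \<open>H m\<close>, so by transitivity the numbers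
  \<open>tr (H m)\<^sup>k\<close> do not depend on \<open>m\<close>. Hence \<open>H\<close> is bounded, and all \<open>H m\<close> have their eigenvalues
  in one finite set; in particular two commuting operators \<open>H m\<close>, \<open>H m'\<close> that are close to each other are
  equal, and then \<open>m = m'\<close> because \<open>b\<close> is separating.

  The distance \<open>D\<close> between \<open>H m\<close> and \<open>H m'\<close> is preserved by the flows. A point minimising \<open>D\<close> to \<open>m\<close> over
  the part of a closed flow-invariant set in a small compact set gives an operator commuting with \<open>H m\<close>, so
  it is \<open>m\<close>. It follows that \<open>D\<close> induces the topology of \<open>M\<close> and that closures of orbits are open, hence
  orbits are dense. As \<open>H\<close> is bounded, finitely many translates of one compact neighbourhood then cover
  \<open>M\<close>, so \<open>M\<close> is compact.\<close>

section \<open>Orthonormal bases and Hermitian operators\<close>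

text \<open>Gram-Schmidt over an abstract field, so that it serves both the complex space
  \<open>'h\<close> and the real space \<open>b\<close>. All properties of \<open>ip\<close> are
  asked for on \<open>V\<close> only, since the form on \<open>b\<close> is bilinear only there;
  \<open>unit\<close> provides the normalisation.\<close>

lemma (in vector_space) ex_orthonormal_basis:
  fixes ip :: "'b \<Rightarrow> 'b \<Rightarrow> 'a"
  assumes V: "subspace V"
    and add: "\<And>x y z. x \<in> V \<Longrightarrow> y \<in> V \<Longrightarrow> z \<in> V \<Longrightarrow> ip x (y + z) = ip x y + ip x z"
    and sc: "\<And>x y a. x \<in> V \<Longrightarrow> y \<in> V \<Longrightarrow> ip x (scale a y) = a * ip x y"
    and sym: "\<And>x y. x \<in> V \<Longrightarrow> y \<in> V \<Longrightarrow> ip x y = 0 \<Longrightarrow> ip y x = 0"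
    and unit: "\<And>x. x \<in> V \<Longrightarrow> x \<noteq> 0 \<Longrightarrow> \<exists>c. ip (scale c x) (scale c x) = 1"
    and fin: "finite S" "span S = V"
  shows "\<exists>E. finite E \<and> span E = V \<and> (\<forall>x\<in>E. \<forall>y\<in>E. ip x y = (if x = y then 1 else 0))"
proof -
  have zero: "ip x 0 = 0" if "x \<in> V" for x
    using sc[OF that subspace_0[OF V], of 0] by simp
  have ipsum: "ip x (\<Sum>e\<in>F. scale (u e) e) = (\<Sum>e\<in>F. u e * ip x e)"
    if "x \<in> V" "finite F" "F \<subseteq> V" for x u F
    using that(2,3)
  proof induction
    case (insert a F)
    then have "(\<Sum>e\<in>F. scale (u e) e) \<in> V"
      by (intro subspace_sum[OF V] subspace_scale[OF V]) auto
    with insert show ?case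
      using that(1) by (simp add: add sc subspace_scale[OF V])
  qed (simp add: zero that)
  have "\<exists>E. finite E \<and> span E = span T \<and> (\<forall>x\<in>E. \<forall>y\<in>E. ip x y = (if x = y then 1 else 0))"
    if "finite T" "T \<subseteq> V" for T
    using that
  proof induction
    case empty
    then show ?case by (intro exI[of _ "{}"]) auto
  next
    case (insert a T)
    then obtain E where E: "finite E" "span E = span T"
      "\<And>x y. x \<in> E \<Longrightarrow> y \<in> E \<Longrightarrow> ip x y = (if x = y then 1 else 0)" by auto
    have EV: "E \<subseteq> V"
      using E(2) insert.prems span_superset[of E] span_minimal[OF _ V, of T] by auto
    have aV: "a \<in> V" using insert.prems by auto
    define p where "p = (\<Sum>e\<in>E. scale (ip e a) e)"
    define r where "r = a - p"
    have pE: "p \<in> span E" unfolding p_def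
      by (intro span_sum span_scale) (auto intro: span_base)
    have pV: "p \<in> V" using pE span_minimal[OF EV V] by auto
    have rV: "r \<in> V" unfolding r_def by (rule subspace_diff[OF V aV pV])
    have orth: "ip e r = 0" if "e \<in> E" for e
    proof -
      have eV: "e \<in> V" using that EV by auto
      have "ip e p = (\<Sum>x\<in>E. ip x a * (if e = x then 1 else 0))"
        unfolding p_def using ipsum[OF eV E(1) EV] E(3)[OF that] by simp
      also have "\<dots> = ip e a" using E(1) that by (simp add: if_distrib cong: if_cong)
      finally have "ip e p = ip e a" .
      moreover have "ip e a = ip e r + ip e p"
        using add[OF eV rV pV] by (simp add: r_def)
      ultimately show ?thesis by simp
    qed
    have "\<And>X Y. span X = span Y \<Longrightarrow> span (insert a X) = span (insert a Y)"
      by (simp add: span_insert)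
    then have s1: "span (insert a T) = span (insert a E)" using E(2) by metis
    have s2: "span (insert r E) = span (insert a E)"
      by (rule eq_span_insert_eq) (use pE in \<open>simp add: r_def span_neg\<close>)
    \<comment> \<open>A zero remainder means that \<open>a\<close> already lies in the span of
      \<open>E\<close>; otherwise the normalised remainder joins \<open>E\<close>.\<close>
    show ?case
    proof (cases "r = 0")
      case True
      then have "span (insert a T) = span E"
        using s1 s2 span_redundant[OF span_zero] by simp
      then show ?thesis using E by (intro exI[of _ E]) auto
    next
      case False
      obtain c where c: "ip (scale c r) (scale c r) = 1" using unit[OF rV False] by auto
      have "c \<noteq> 0" using c zero[OF subspace_0[OF V]] by auto
      define u where "u = scale c r"
      have uV: "u \<in> V" unfolding u_def by (rule subspace_scale[OF V rV])
      have r: "r = scale (inverse c) u" using \<open>c \<noteq> 0\<close> by (simp add: u_def)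
      have "span (insert u E) = span (insert r E)"
      proof (rule span_eq[THEN iffD2], intro conjI)
        show "insert u E \<subseteq> span (insert r E)"
          unfolding u_def by (auto intro: span_base span_scale)
        have "r \<in> span (insert u E)" unfolding r by (intro span_scale span_base) auto
        then show "insert r E \<subseteq> span (insert u E)" by (auto intro: span_base)
      qed
      moreover have eu: "ip e u = 0" if "e \<in> E" for e
        unfolding u_def using sc rV orth[OF that] that EV by auto
      moreover have ue: "ip u e = 0" if "e \<in> E" for e
        using eu[OF that] sym uV that EV by auto
      moreover have "u \<notin> E" using eu c u_def by force
      ultimately show ?thesis using E c s1 s2
        by (intro exI[of _ "insert u E"]) (auto simp: u_def[symmetric])
    qed
  qed
  moreover have "S \<subseteq> V" using fin span_superset by auto
  ultimately show ?thesis using fin by metis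
qed

text \<open>The vectors equal to their expansion form a subspace that contains \<open>E\<close>,
  hence contains its span.\<close>

lemma (in vector_space) orthonormal_expansion:
  fixes ip :: "'b \<Rightarrow> 'b \<Rightarrow> 'a"
  assumes V: "subspace V"
    and add: "\<And>x y z. x \<in> V \<Longrightarrow> y \<in> V \<Longrightarrow> z \<in> V \<Longrightarrow> ip x (y + z) = ip x y + ip x z"
    and sc: "\<And>x y a. x \<in> V \<Longrightarrow> y \<in> V \<Longrightarrow> ip x (scale a y) = a * ip x y"
    and E: "finite E" "span E = V" "\<And>x y. x \<in> E \<Longrightarrow> y \<in> E \<Longrightarrow> ip x y = (if x = y then 1 else 0)"
    and x: "x \<in> V"
  shows "(\<Sum>e\<in>E. scale (ip e x) e) = x"
proof -
  have EV: "E \<subseteq> V" using E(2) span_superset by auto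
  have S: "subspace {x \<in> V. (\<Sum>e\<in>E. scale (ip e x) e) = x}"
  proof (rule subspaceI)
    have "ip e 0 = 0" if "e \<in> E" for e
      using sc[of e 0 0] that EV subspace_0[OF V] by auto
    then show "0 \<in> {x \<in> V. (\<Sum>e\<in>E. scale (ip e x) e) = x}"
      using subspace_0[OF V] by simp
  next
    fix y z
    assume a: "y \<in> {x \<in> V. (\<Sum>e\<in>E. scale (ip e x) e) = x}" "z \<in> {x \<in> V. (\<Sum>e\<in>E. scale (ip e x) e) = x}"
    then have "(\<Sum>e\<in>E. scale (ip e (y + z)) e) = (\<Sum>e\<in>E. scale (ip e y) e + scale (ip e z) e)"
      using EV by (intro sum.cong) (auto simp: add subset_iff scale_left_distrib)
    with a show "y + z \<in> {x \<in> V. (\<Sum>e\<in>E. scale (ip e x) e) = x}"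
      by (auto simp: sum.distrib subspace_add[OF V])
  next
    fix c y
    assume a: "y \<in> {x \<in> V. (\<Sum>e\<in>E. scale (ip e x) e) = x}"
    then have "(\<Sum>e\<in>E. scale (ip e (scale c y)) e) = (\<Sum>e\<in>E. scale c (scale (ip e y) e))"
      using EV by (intro sum.cong) (auto simp: sc subset_iff)
    with a show "scale c y \<in> {x \<in> V. (\<Sum>e\<in>E. scale (ip e x) e) = x}"
      by (auto simp: scale_sum_right[symmetric] subspace_scale[OF V] simp del: scale_scale)
  qed
  have "E \<subseteq> {x \<in> V. (\<Sum>e\<in>E. scale (ip e x) e) = x}"
  proof
    fix y assume y: "y \<in> E"
    have "(\<Sum>e\<in>E. scale (ip e y) e) = (\<Sum>e\<in>E. if e = y then y else 0)"
      by (intro sum.cong) (use y E(3) in auto)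
    then show "y \<in> {x \<in> V. (\<Sum>e\<in>E. scale (ip e x) e) = x}"
      using E(1) y EV by auto
  qed
  from span_minimal[OF this S] show ?thesis using E(2) x by auto
qed

section \<open>Finite-dimensional complex inner product spaces\<close>

context finite_dim_complex_hilbert
begin

lemma ip_zero [simp]: "ip x 0 = 0" "ip 0 x = 0"
  using ip_scale[of x 0 0] ip_commute[of x 0] by auto

lemma ip_add_left: "ip (x + y) z = ip x z + ip y z"
  by (simp add: ip_commute[of _ z] ip_add)

lemma ip_scale_left: "ip (cscale a x) y = cnj a * ip x y"
  by (simp add: ip_commute[of _ y] ip_scale)

lemma ip_diff: "ip x (y - z) = ip x y - ip x z"
  using ip_add[of x "y - z" z] by simp

lemma ip_diff_left: "ip (x - y) z = ip x z - ip y z"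
  using ip_add_left[of "x - y" y z] by simp

lemma ip_sum: "ip x (\<Sum>i\<in>I. f i) = (\<Sum>i\<in>I. ip x (f i))"
  by (induction I rule: infinite_finite_induct) (auto simp: ip_add)

lemma ip_sum_left: "ip (\<Sum>i\<in>I. f i) x = (\<Sum>i\<in>I. ip (f i) x)"
  by (induction I rule: infinite_finite_induct) (auto simp: ip_add_left)

lemma ip_self_real: "ip x x = complex_of_real (Re (ip x x))"
  using ip_commute[of x x] by (simp add: complex_eq_iff)

lemma ip_self_nonneg: "Re (ip x x) \<ge> 0"
  using ip_positive[of x] by (cases "x = 0") auto

lemma ip_self_eq_0_iff [simp]: "Re (ip x x) = 0 \<longleftrightarrow> x = 0"
  using ip_positive[of x] by (cases "x = 0") auto

lemma ex_unit_multiple: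
  assumes "x \<noteq> 0" shows "\<exists>c. ip (cscale c x) (cscale c x) = 1"
proof -
  define r where "r = Re (ip x x)"
  have "r > 0" using ip_positive[OF assms] by (simp add: r_def)
  then have "inverse (sqrt r) * (inverse (sqrt r) * r) = 1"
    by (simp add: field_simps flip: real_sqrt_mult)
  then have "complex_of_real (inverse (sqrt r)) * (complex_of_real (inverse (sqrt r)) * complex_of_real r) = 1"
    by (metis of_real_1 of_real_mult)
  then have "ip (cscale (complex_of_real (inverse (sqrt r))) x) (cscale (complex_of_real (inverse (sqrt r))) x) = 1"
    using ip_self_real[of x] by (simp only: ip_scale ip_scale_left complex_cnj_complex_of_real r_def[symmetric])
  then show ?thesis by blast
qed

end

locale complex_onb = finite_dim_complex_hilbert cscale ip
  for cscale :: "complex \<Rightarrow> 'h::ab_group_add \<Rightarrow> 'h" and ip +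
  fixes B :: "'h set"
  assumes finite_B: "finite B" and span_B: "span B = UNIV"
    and orthonormal: "x \<in> B \<Longrightarrow> y \<in> B \<Longrightarrow> ip x y = (if x = y then 1 else 0)"

lemma (in finite_dim_complex_hilbert) ex_complex_onb: "\<exists>B. complex_onb cscale ip B"
proof -
  obtain S where S: "finite S" "span S = UNIV" using finite_dim by auto
  have "\<exists>E. finite E \<and> span E = UNIV \<and> (\<forall>x\<in>E. \<forall>y\<in>E. ip x y = (if x = y then 1 else 0))"
  proof (rule ex_orthonormal_basis[OF _ _ _ _ _ S])
    show "ip y x = 0" if "ip x y = 0" for x y using ip_commute[of y x] that by simp
    show "\<exists>c. ip (cscale c x) (cscale c x) = 1" if "x \<noteq> 0" for x
      using ex_unit_multiple[OF that] .
  qed (auto simp: ip_add ip_scale)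
  then obtain E where "finite E" "span E = UNIV" "\<forall>x\<in>E. \<forall>y\<in>E. ip x y = (if x = y then 1 else 0)"
    by auto
  then have "complex_onb cscale ip E" by unfold_locales auto
  then show ?thesis by blast
qed

section \<open>Traces, symmetric operators and the Hilbert-Schmidt norm\<close>

context complex_onb
begin

abbreviation lin :: "('h \<Rightarrow> 'h) \<Rightarrow> bool" where "lin T \<equiv> Vector_Spaces.linear cscale cscale T"
abbreviation sym :: "('h \<Rightarrow> 'h) \<Rightarrow> bool" where "sym T \<equiv> symmetric_operator cscale ip T"

definition tr :: "('h \<Rightarrow> 'h) \<Rightarrow> complex" where "tr T = (\<Sum>e\<in>B. ip e (T e))"

lemma expansion: "(\<Sum>e\<in>B. cscale (ip e x) e) = x"
  by (rule orthonormal_expansion[of UNIV]) (auto simp: ip_add ip_scale finite_B span_B orthonormal)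

lemma parseval: "ip x y = (\<Sum>e\<in>B. ip x e * ip e y)"
proof -
  have "ip x y = ip x (\<Sum>e\<in>B. cscale (ip e y) e)" by (simp add: expansion)
  also have "\<dots> = (\<Sum>e\<in>B. ip x e * ip e y)" by (simp add: ip_sum ip_scale mult.commute)
  finally show ?thesis .
qed

lemma linD: assumes "lin T"
  shows "T (x + y) = T x + T y" "T (cscale a x) = cscale a (T x)" "T 0 = 0" "T (x - y) = T x - T y"
    "T (\<Sum>i\<in>I. f i) = (\<Sum>i\<in>I. T (f i))" "T (- x) = - T x"
proof -
  interpret T: Vector_Spaces.linear cscale cscale T by (rule assms)
  show "T (x + y) = T x + T y" "T (cscale a x) = cscale a (T x)" "T 0 = 0" "T (x - y) = T x - T y"
    "T (\<Sum>i\<in>I. f i) = (\<Sum>i\<in>I. T (f i))" "T (- x) = - T x"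
    by (simp_all add: T.add T.scale T.zero T.diff T.sum T.neg)
qed

lemma lin_sum_onb: assumes "lin T" shows "T x = (\<Sum>e\<in>B. cscale (ip e x) (T e))"
  using linD(5)[OF assms, of "\<lambda>e. cscale (ip e x) e" B] by (simp add: expansion linD(2)[OF assms])

lemma linI: assumes "\<And>x y. T (x + y) = T x + T y" "\<And>a x. T (cscale a x) = cscale a (T x)"
  shows "lin T"
  using assms by (auto simp: Vector_Spaces.linear_iff vector_space_axioms)

lemma lin_comp: "lin S \<Longrightarrow> lin T \<Longrightarrow> lin (S \<circ> T)"
  by (auto intro!: linI simp: linD)

lemma lin_funpow: "lin T \<Longrightarrow> lin (T ^^ k)"
  by (induction k) (auto intro!: linI simp: linD)

text \<open>Expanding the inner vector in the basis turns both traces into double sums over matrix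
  entries, which differ only in the order of summation.\<close>

lemma tr_commute:
  assumes "lin S" "lin T" shows "tr (S \<circ> T) = tr (T \<circ> S)"
proof -
  have "ip e (S (T e)) = (\<Sum>e'\<in>B. ip e' (T e) * ip e (S e'))" for e
    by (subst lin_sum_onb[OF assms(1)]) (simp add: ip_sum ip_scale)
  moreover have "ip e (T (S e)) = (\<Sum>e'\<in>B. ip e' (S e) * ip e (T e'))" for e
    by (subst lin_sum_onb[OF assms(2)]) (simp add: ip_sum ip_scale)
  ultimately have "tr (S \<circ> T) = (\<Sum>e\<in>B. \<Sum>e'\<in>B. ip e' (T e) * ip e (S e'))"
    "tr (T \<circ> S) = (\<Sum>e\<in>B. \<Sum>e'\<in>B. ip e' (S e) * ip e (T e'))"
    by (simp_all add: tr_def)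
  then show ?thesis by (subst (asm) sum.swap) (simp add: mult.commute)
qed

lemma symD: assumes "sym T" shows "lin T" "ip (T x) y = ip x (T y)"
  using assms by (auto simp: symmetric_operator_def)

lemma sym_funpow: assumes "sym T" shows "ip ((T ^^ k) x) y = ip x ((T ^^ k) y)"
proof (induction k arbitrary: y)
  case (Suc k)
  then show ?case using funpow_swap1[of T k y] by (simp add: symD(2)[OF assms])
qed simp

text \<open>The square of the Hilbert-Schmidt norm.\<close>

definition hs :: "('h \<Rightarrow> 'h) \<Rightarrow> real" where "hs T = (\<Sum>e\<in>B. Re (ip (T e) (T e)))"

lemma hs_nonneg: "hs T \<ge> 0"
  unfolding hs_def by (intro sum_nonneg) (auto simp: ip_self_nonneg)

lemma hs_eq_0D: assumes "hs T = 0" "lin T" shows "T x = 0"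
proof -
  have "T e = 0" if "e \<in> B" for e
    using assms(1) that unfolding hs_def
    by (subst (asm) sum_nonneg_eq_0_iff) (auto simp: finite_B ip_self_nonneg)
  then show ?thesis by (subst lin_sum_onb[OF assms(2)]) simp
qed

lemma cauchy_schwarz: "(norm (ip x y))\<^sup>2 \<le> Re (ip x x) * Re (ip y y)"
proof (cases "y = 0")
  case False
  define r where "r = Re (ip y y)"
  have r: "r > 0" "ip y y = of_real r" using ip_positive[OF False] ip_self_real[of y] by (auto simp: r_def)
  \<comment> \<open>With this \<open>c\<close> the vector \<open>x - cscale c y\<close> is
    orthogonal to \<open>y\<close>; its norm being nonnegative is the claim.\<close>
  define c where "c = ip y x / of_real r"
  have xy: "ip x y = cnj (ip y x)" by (rule ip_commute)
  have n: "ip y x * cnj (ip y x) = of_real ((norm (ip y x))\<^sup>2)"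
    by (simp only: complex_norm_square)
  have "ip (x - cscale c y) (x - cscale c y) = ip x x - c * ip x y - cnj c * ip y x + cnj c * c * ip y y"
    by (simp add: ip_diff ip_diff_left ip_scale ip_scale_left algebra_simps)
  also have "\<dots> = ip x x - of_real ((norm (ip y x))\<^sup>2 / r)"
    using r n by (simp add: c_def xy field_simps)
  finally have "Re (ip x x) - (norm (ip y x))\<^sup>2 / r \<ge> 0"
    using ip_self_nonneg[of "x - cscale c y"] by simp
  then have "(norm (ip y x))\<^sup>2 \<le> Re (ip x x) * r" using r(1) by (simp add: field_simps)
  moreover have "norm (ip x y) = norm (ip y x)" unfolding xy by simp
  ultimately show ?thesis unfolding r_def by simp
qed simp

text \<open>By Parseval the squared norm of \<open>T v\<close> is the sum of the squares of
  \<open>ip e (T v)\<close>. Symmetry moves \<open>T\<close> onto the basis vectors, and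
  Cauchy-Schwarz bounds each term by the squared norm of \<open>T e\<close> times that of
  \<open>v\<close>.\<close>

lemma hs_eigenvalue_bound:
  assumes T: "sym T" and v: "T v = cscale c v" "v \<noteq> 0"
  shows "(norm c)\<^sup>2 \<le> hs T"
proof -
  define r where "r = Re (ip v v)"
  have r: "r > 0" using ip_positive[OF v(2)] by (simp add: r_def)
  have "ip (T v) (T v) = (c * cnj c) * ip v v"
    by (simp add: v(1) ip_scale ip_scale_left)
  also have "\<dots> = of_real ((norm c)\<^sup>2 * r)"
    unfolding complex_norm_square[symmetric] r_def of_real_mult using ip_self_real[of v] by simp
  finally have "(norm c)\<^sup>2 * r = Re (ip (T v) (T v))" by simp
  also have "\<dots> = (\<Sum>e\<in>B. (norm (ip e (T v)))\<^sup>2)"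
  proof -
    have "ip (T v) e * ip e (T v) = of_real ((norm (ip e (T v)))\<^sup>2)" for e
      using ip_commute[of "T v" e] complex_norm_square[of "ip e (T v)"] by (simp add: mult.commute)
    then show ?thesis by (subst parseval) simp
  qed
  also have "\<dots> \<le> (\<Sum>e\<in>B. Re (ip (T e) (T e)) * r)"
    unfolding r_def by (intro sum_mono) (metis cauchy_schwarz symD(2)[OF T])
  also have "\<dots> = hs T * r" by (simp add: hs_def sum_distrib_right)
  finally show ?thesis using r by simp
qed

end

section \<open>Polynomials in an operator and isospectral symmetric operators\<close>

context complex_onb
begin

text \<open>The operator \<open>p(T)\<close>, applied to \<open>x\<close>.\<close>

definition opoly :: "complex poly \<Rightarrow> ('h \<Rightarrow> 'h) \<Rightarrow> 'h \<Rightarrow> 'h"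
  where "opoly p T x = (\<Sum>i\<le>degree p. cscale (coeff p i) ((T ^^ i) x))"

lemma opoly_altdef:
  assumes "degree p \<le> n"
  shows "opoly p T x = (\<Sum>i\<le>n. cscale (coeff p i) ((T ^^ i) x))"
  unfolding opoly_def using assms
  by (intro sum.mono_neutral_left) (auto simp: coeff_eq_0)

lemma opoly_0 [simp]: "opoly 0 T x = 0"
  by (simp add: opoly_def)

lemma opoly_pCons:
  assumes "lin T" shows "opoly (pCons a p) T x = cscale a x + T (opoly p T x)"
proof -
  have "opoly (pCons a p) T x = (\<Sum>i\<le>Suc (degree p). cscale (coeff (pCons a p) i) ((T ^^ i) x))"
    by (rule opoly_altdef) (simp add: degree_pCons_le)
  also have "\<dots> = cscale a x + T (opoly p T x)"
    by (subst sum.atMost_Suc_shift) (simp add: opoly_def linD[OF assms])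
  finally show ?thesis .
qed

lemma opoly_add: "opoly (p + q) T x = opoly p T x + opoly q T x"
proof -
  define n where "n = max (degree p) (degree q)"
  have "degree (p + q) \<le> n" "degree p \<le> n" "degree q \<le> n"
    by (auto simp: n_def degree_add_le_max)
  then show ?thesis by (simp add: opoly_altdef scale_left_distrib sum.distrib)
qed

lemma opoly_smult: "opoly (smult c p) T x = cscale c (opoly p T x)"
  by (simp add: opoly_altdef[OF degree_smult_le] opoly_def scale_sum_right)

lemma opoly_mult: assumes "lin T" shows "opoly (p * q) T x = opoly p T (opoly q T x)"
  by (induction p) (simp_all add: opoly_pCons[OF assms] opoly_add opoly_smult)

lemma opoly_commute: assumes "lin T" shows "opoly p T (opoly q T x) = opoly q T (opoly p T x)"
  using opoly_mult[OF assms, of p q x] opoly_mult[OF assms, of q p x] by (simp add: mult.commute)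

lemma opoly_zero_right: assumes "lin T" shows "opoly p T 0 = 0"
  by (induction p) (simp_all add: opoly_pCons[OF assms] linD[OF assms])

lemma opoly_lin: assumes "lin T" shows "lin (opoly p T)"
proof (induction p)
  case 0
  show ?case by (rule linI) simp_all
next
  case (pCons a p)
  show ?case
    by (rule linI)
      (simp_all add: opoly_pCons[OF assms] linD[OF assms] linD[OF pCons.IH] scale_right_distrib mult.commute)
qed

lemma opoly_eigenvector:
  assumes "lin T" "T v = cscale c v" shows "opoly p T v = cscale (poly p c) v"
  by (induction p)
    (simp_all add: opoly_pCons[OF assms(1)] linD[OF assms(1)] assms(2) scale_left_distrib mult.commute)

text \<open>The iterates of \<open>v\<close> up to exponent \<open>card B\<close> are one too many
  to be independent, and a linear dependence between them is the polynomial. If two iterates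
  coincide they do not form a set of that size, but then a difference of two monomials
  works.\<close>

lemma ex_annihilating_poly_vector:
  assumes "lin T" shows "\<exists>p. p \<noteq> 0 \<and> opoly p T v = 0"
proof (cases "inj_on (\<lambda>k. (T ^^ k) v) {..card B}")
  case True
  define V where "V = (\<lambda>k. (T ^^ k) v) ` {..card B}"
  have "card V = Suc (card B)" unfolding V_def by (simp add: card_image[OF True])
  then have "dependent V"
    using independent_span_bound[OF finite_B, of V] span_B by auto
  moreover have "finite V" by (simp add: V_def)
  ultimately obtain u where u: "\<exists>w\<in>V. u w \<noteq> 0" "(\<Sum>w\<in>V. cscale (u w) w) = 0"
    using dependent_finite by blast
  define p where "p = Poly (map (\<lambda>k. u ((T ^^ k) v)) [0..<Suc (card B)])"
  have c: "coeff p k = (if k \<le> card B then u ((T ^^ k) v) else 0)" for k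
    by (auto simp: p_def coeff_Poly_eq nth_default_def simp del: upt_Suc)
  have "degree p \<le> card B" by (rule degree_le) (auto simp: c)
  then have "opoly p T v = (\<Sum>k\<le>card B. cscale (u ((T ^^ k) v)) ((T ^^ k) v))"
    by (simp add: opoly_altdef c)
  also have "\<dots> = (\<Sum>w\<in>V. cscale (u w) w)"
    unfolding V_def by (simp add: sum.reindex[OF True])
  finally have "opoly p T v = 0" using u by simp
  moreover have "p \<noteq> 0" using u(1) c unfolding V_def by (metis (no_types, lifting) atMost_iff coeff_0 imageE)
  ultimately show ?thesis by blast
next
  case False
  then obtain i j where ij: "i \<noteq> j" "(T ^^ i) v = (T ^^ j) v" by (auto simp: inj_on_def)
  have mono: "opoly (monom c k) T v = cscale c ((T ^^ k) v)" for c k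
    by (subst opoly_altdef[OF degree_monom_le]) (simp add: if_distrib[of "\<lambda>a. cscale a _"] cong: if_cong)
  have "opoly (monom 1 i + monom (-1) j) T v = 0"
    by (simp add: opoly_add mono ij)
  moreover have "coeff (monom 1 i + monom (-1) j :: complex poly) i = 1" using ij by simp
  then have "monom 1 i + monom (-1) j \<noteq> (0 :: complex poly)" by (metis coeff_0 zero_neq_one)
  ultimately show ?thesis by blast
qed

text \<open>Polynomials in \<open>T\<close> commute, so the product of annihilators of the single
  basis vectors annihilates every basis vector.\<close>

lemma ex_annihilating_poly:
  assumes "lin T" shows "\<exists>p. p \<noteq> 0 \<and> (\<forall>x. opoly p T x = 0)"
proof -
  have "\<exists>p. p \<noteq> 0 \<and> (\<forall>e\<in>C. opoly p T e = 0)" if "finite C" for C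
    using that
  proof induction
    case empty
    then show ?case by (intro exI[of _ 1]) auto
  next
    case (insert e C)
    then obtain p q where "p \<noteq> 0" "\<forall>e\<in>C. opoly p T e = 0" "q \<noteq> 0" "opoly q T e = 0"
      using ex_annihilating_poly_vector[OF assms, of e] by auto
    then have "opoly (p * q) T x = 0" if "x \<in> insert e C" for x
      using that opoly_commute[OF assms, of p q x]
      by (auto simp: opoly_mult[OF assms] opoly_zero_right[OF assms])
    with \<open>p \<noteq> 0\<close> \<open>q \<noteq> 0\<close> show ?case by (metis mult_eq_0_iff)
  qed
  then obtain p where p: "p \<noteq> 0" "\<forall>e\<in>B. opoly p T e = 0" using finite_B by blast
  have "opoly p T x = 0" for x
    by (subst lin_sum_onb[OF opoly_lin[OF assms]]) (simp add: p)
  then show ?thesis using p by blast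
qed

text \<open>Split a root \<open>c\<close> off a nonzero \<open>p\<close> of least degree with
  \<open>p(T) v = 0\<close>. By minimality the cofactor does not annihilate \<open>v\<close>, so it
  maps \<open>v\<close> to an eigenvector, which stays in \<open>E\<close>. The invariant subspace
  is what later yields common eigenvectors.\<close>

lemma ex_eigenvector:
  assumes "lin T" and E: "subspace E" "\<And>x. x \<in> E \<Longrightarrow> T x \<in> E" and v: "v \<in> E" "v \<noteq> 0"
  shows "\<exists>w c. w \<in> E \<and> w \<noteq> 0 \<and> T w = cscale c w"
proof -
  have opE: "opoly p T v \<in> E" for p
    by (induction p) (auto simp: opoly_pCons[OF assms(1)] E v subspace_0 subspace_add subspace_scale)
  define P where "P = (\<lambda>p. p \<noteq> 0 \<and> opoly p T v = 0)"
  obtain p where p: "P p" "\<And>q. P q \<Longrightarrow> degree p \<le> degree q"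
    using ex_annihilating_poly_vector[OF assms(1), of v] ex_has_least_nat[of P _ degree]
    unfolding P_def by blast
  have "degree p \<noteq> 0"
  proof
    assume "degree p = 0"
    then obtain a where "p = [:a:]" by (rule degree_eq_zeroE)
    with p(1) v(2) show False by (simp add: P_def opoly_pCons[OF assms(1)] linD[OF assms(1)])
  qed
  then obtain c where "poly p c = 0"
    using fundamental_theorem_of_algebra[of p] by (metis constant_degree)
  then obtain q where q: "p = [:- c, 1:] * q" by (auto simp: poly_eq_0_iff_dvd)
  have "q \<noteq> 0" using p(1) by (auto simp: P_def q)
  then have "degree p = Suc (degree q)" unfolding q by (subst degree_mult_eq) auto
  then have "\<not> P q" using p(2)[of q] by auto
  then have "opoly q T v \<noteq> 0" using \<open>q \<noteq> 0\<close> by (simp add: P_def)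
  moreover have "T (opoly q T v) = cscale c (opoly q T v)"
  proof -
    have "opoly [:- c, 1:] T (opoly q T v) = 0"
      using p(1) unfolding P_def q opoly_mult[OF assms(1)] by blast
    then show ?thesis by (simp add: opoly_pCons[OF assms(1)] linD[OF assms(1)])
  qed
  ultimately show ?thesis using opE by blast
qed

text \<open>The point is that the right side sees \<open>T\<close> only through the traces of its
  powers. Symmetry collects the powers:
  \<open>ip (T^i e) (T^j e) = ip e (T^(i+j) e)\<close>.\<close>

lemma sum_norm_opoly:
  assumes "sym T"
  shows "(\<Sum>e\<in>B. ip (opoly p T e) (opoly p T e)) =
    (\<Sum>i\<le>degree p. \<Sum>j\<le>degree p. cnj (coeff p i) * coeff p j * tr (T ^^ (i + j)))"
proof -
  have "ip ((T ^^ i) e) ((T ^^ j) e) = ip e ((T ^^ (i + j)) e)" for i j e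
    by (simp add: sym_funpow[OF assms] funpow_add)
  then have "(\<Sum>e\<in>B. ip (opoly p T e) (opoly p T e)) =
    (\<Sum>e\<in>B. \<Sum>i\<le>degree p. \<Sum>j\<le>degree p. cnj (coeff p i) * coeff p j * ip e ((T ^^ (i + j)) e))"
    by (simp only: opoly_def ip_sum_left)
      (simp add: ip_sum ip_scale ip_scale_left mult_ac sum_distrib_left)
  also have "\<dots> = (\<Sum>i\<le>degree p. \<Sum>j\<le>degree p. \<Sum>e\<in>B. cnj (coeff p i) * coeff p j * ip e ((T ^^ (i + j)) e))"
    by (subst sum.swap, subst sum.swap[of _ _ B]) simp
  finally show ?thesis by (simp add: tr_def sum_distrib_left)
qed

text \<open>An operator vanishes when its Hilbert-Schmidt norm does, and for \<open>p(T)\<close>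
  that norm is determined by the traces of powers. This takes the place of comparing the spectra of
  \<open>S\<close> and \<open>T\<close>.\<close>

lemma opoly_eq_0_transfer:
  assumes "sym T" "sym S" "\<And>k. tr (S ^^ k) = tr (T ^^ k)" "\<And>x. opoly p T x = 0"
  shows "opoly p S x = 0"
proof -
  have "(\<Sum>e\<in>B. ip (opoly p S e) (opoly p S e)) = (\<Sum>e\<in>B. ip (opoly p T e) (opoly p T e))"
    unfolding sum_norm_opoly[OF assms(1)] sum_norm_opoly[OF assms(2)] assms(3) ..
  also have "\<dots> = 0" using assms(4) by simp
  finally have "hs (opoly p S) = 0" unfolding hs_def by (simp flip: Re_sum)
  then show ?thesis using opoly_lin[OF symD(1)[OF assms(2)]] by (rule hs_eq_0D)
qed

lemma sym_diff: assumes "sym S" "sym T" shows "sym (\<lambda>x. S x - T x)"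
  using assms by (auto simp: symmetric_operator_def linD ip_diff ip_diff_left scale_right_diff_distrib intro!: linI)

text \<open>The range of \<open>T\<close> is invariant and nonzero, so it contains an eigenvector
  \<open>T y\<close>. Eigenvalue 0 would put \<open>T y\<close> in the kernel too, and for symmetric
  \<open>T\<close> this makes \<open>T y\<close> orthogonal to itself.\<close>

lemma sym_ex_nonzero_eigenvalue:
  assumes T: "sym T" and "T x \<noteq> 0"
  shows "\<exists>v c. v \<noteq> 0 \<and> c \<noteq> 0 \<and> T v = cscale c v"
proof -
  have l: "lin T" by (rule symD(1)[OF T])
  have "subspace (range T)"
  proof (rule subspaceI)
    show "0 \<in> range T" using linD(3)[OF l] by (metis rangeI)
    show "x + y \<in> range T" if "x \<in> range T" "y \<in> range T" for x y
      using that by (auto simp: linD(1)[OF l, symmetric])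
    show "cscale a x \<in> range T" if "x \<in> range T" for a x
      using that by (auto simp: linD(2)[OF l, symmetric])
  qed
  from ex_eigenvector[OF l this, of "T x"] assms(2)
  obtain y c where y: "T y \<noteq> 0" "T (T y) = cscale c (T y)" by blast
  have "c \<noteq> 0"
  proof
    assume "c = 0"
    then have "T (T y) = 0" using y by simp
    then have "ip (T y) (T y) = 0" using symD(2)[OF T, of y "T y"] by simp
    then show False using y(1) ip_self_eq_0_iff[of "T y"] by simp
  qed
  with y show ?thesis by blast
qed

text \<open>A common eigenvector of the commuting operators \<open>S - S'\<close> and \<open>S'\<close> shows that a nonzero
  eigenvalue of \<open>S - S'\<close> is a difference of two roots of a polynomial annihilating \<open>T\<close>.\<close>

lemma isospectral_commuting_gap:
  assumes T: "sym T"
  shows "\<exists>\<delta>>0. \<forall>S S'. sym S \<longrightarrow> sym S' \<longrightarrow> (\<forall>k. tr (S ^^ k) = tr (T ^^ k)) \<longrightarrow>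
    (\<forall>k. tr (S' ^^ k) = tr (T ^^ k)) \<longrightarrow> (\<forall>x. S (S' x) = S' (S x)) \<longrightarrow>
    hs (\<lambda>x. S x - S' x) < \<delta> \<longrightarrow> S = S'"
proof -
  obtain p where p: "p \<noteq> 0" "\<And>x. opoly p T x = 0"
    using ex_annihilating_poly[OF symD(1)[OF T]] by blast
  define Z where "Z = {z. poly p z = 0}"
  have "finite Z" unfolding Z_def by (rule poly_roots_finite[OF p(1)])
  define D where "D = (\<lambda>(z, w). (norm (z - w))\<^sup>2) ` (Z \<times> Z) - {0}"
  have D: "finite D" "\<And>x. x \<in> D \<Longrightarrow> x > 0" using \<open>finite Z\<close> by (auto simp: D_def)
  \<comment> \<open>The least squared distance between distinct roots, capped at 1; the 1 also keeps
    \<open>Min\<close> meaningful when \<open>D\<close> is empty.\<close>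
  define \<delta> where "\<delta> = Min (insert 1 D)"
  have "\<delta> > 0" using D by (simp add: \<delta>_def)
  have "S = S'" if S: "sym S" "sym S'" "\<And>k. tr (S ^^ k) = tr (T ^^ k)" "\<And>k. tr (S' ^^ k) = tr (T ^^ k)"
    "\<And>x. S (S' x) = S' (S x)" "hs (\<lambda>x. S x - S' x) < \<delta>" for S S'
  proof (rule ccontr)
    assume "S \<noteq> S'"
    define R where "R = (\<lambda>x. S x - S' x)"
    have R: "sym R" unfolding R_def by (rule sym_diff[OF S(1,2)])
    obtain x where "R x \<noteq> 0" using \<open>S \<noteq> S'\<close> by (auto simp: R_def fun_eq_iff)
    then obtain v c where v: "v \<noteq> 0" "c \<noteq> 0" "R v = cscale c v"
      using sym_ex_nonzero_eigenvalue[OF R] by blast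
    have lS: "lin S" and lS': "lin S'" and lR: "lin R" using symD(1) S(1,2) R by auto
    \<comment> \<open>\<open>S'\<close> commutes with \<open>R\<close> and so preserves this
      eigenspace, which therefore contains an eigenvector of \<open>S'\<close>.\<close>
    have "subspace {x. R x = cscale c x}"
      by (rule subspaceI) (auto simp: linD[OF lR] scale_right_distrib mult.commute)
    moreover have "S' x \<in> {x. R x = cscale c x}" if "x \<in> {x. R x = cscale c x}" for x
    proof -
      have "R (S' x) = S' (R x)" by (simp add: R_def S(5) linD[OF lS'])
      with that show ?thesis by (simp add: linD[OF lS'])
    qed
    ultimately obtain w d where w: "R w = cscale c w" "w \<noteq> 0" "S' w = cscale d w"
      using ex_eigenvector[OF lS', of "{x. R x = cscale c x}" v] v by auto
    have "S w = cscale (c + d) w"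
      using w by (simp add: R_def scale_left_distrib algebra_simps)
    moreover have "opoly p S w = 0" "opoly p S' w = 0"
      using opoly_eq_0_transfer[OF T S(1) S(3) p(2)] opoly_eq_0_transfer[OF T S(2) S(4) p(2)] by auto
    ultimately have "c + d \<in> Z" "d \<in> Z"
      using opoly_eigenvector[OF lS, of w "c + d" p] opoly_eigenvector[OF lS', of w d p] w
      by (auto simp: Z_def)
    then have "(norm ((c + d) - d))\<^sup>2 \<in> (\<lambda>(z, w). (norm (z - w))\<^sup>2) ` (Z \<times> Z)"
      by (intro image_eqI[of _ _ "(c + d, d)"]) auto
    then have "(norm c)\<^sup>2 \<in> D" unfolding D_def using v(2) by simp
    then have "\<delta> \<le> (norm c)\<^sup>2" unfolding \<delta>_def using D by (intro Min_le) auto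
    also have "\<dots> \<le> hs R" by (rule hs_eigenvalue_bound[OF R w(1,2)])
    finally show False using S(6) by (simp add: R_def)
  qed
  then show ?thesis using \<open>\<delta> > 0\<close> by blast
qed

end

section \<open>Isometric flows\<close>

text \<open>The topological part of the argument, isolated from operators. A point is recorded by
  its coordinates \<open>e m\<close> for \<open>e \<in> E\<close>; along each curve in
  \<open>\<Gamma> f\<close> they solve a linear equation with antisymmetric matrix
  \<open>c f\<close>. The double sum in \<open>gap\<close> is the inner product of the coordinate
  vector of \<open>m\<close> with the velocity of that of \<open>m'\<close> under
  \<open>f\<close>.\<close>

locale isometric_flows =
  fixes E :: "('m::t2_space \<Rightarrow> real) set" and F :: "'f set"
    and \<Gamma> :: "'f \<Rightarrow> (real \<Rightarrow> 'm) set"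
    and c :: "'f \<Rightarrow> ('m \<Rightarrow> real) \<Rightarrow> ('m \<Rightarrow> real) \<Rightarrow> real" and N \<delta> :: real
  assumes finite_E: "finite E"
    and cont_E: "e \<in> E \<Longrightarrow> continuous_on UNIV e"
    and separating_E: "(\<And>e. e \<in> E \<Longrightarrow> e m = e m') \<Longrightarrow> m = m'"
    and bounded_E: "(\<Sum>e\<in>E. (e m)\<^sup>2) \<le> N"
    and curve_ex: "f \<in> F \<Longrightarrow> \<exists>\<gamma>\<in>\<Gamma> f. \<gamma> 0 = m"
    and curve_shift: "\<gamma> \<in> \<Gamma> f \<Longrightarrow> (\<lambda>t. \<gamma> (s + t)) \<in> \<Gamma> f"
    and curve_cont: "\<gamma> \<in> \<Gamma> f \<Longrightarrow> continuous_on UNIV \<gamma>"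
    and curve_deriv: "f \<in> F \<Longrightarrow> \<gamma> \<in> \<Gamma> f \<Longrightarrow> e \<in> E \<Longrightarrow>
      ((\<lambda>t. e (\<gamma> t)) has_real_derivative (\<Sum>j\<in>E. c f e j * j (\<gamma> t))) (at t)"
    and antisym_c: "f \<in> F \<Longrightarrow> e \<in> E \<Longrightarrow> j \<in> E \<Longrightarrow> c f e j = - c f j e"
    and gap_pos: "\<delta> > 0"
    and gap: "(\<And>f. f \<in> F \<Longrightarrow> (\<Sum>e\<in>E. \<Sum>j\<in>E. c f e j * e m * j m') = 0) \<Longrightarrow>
      L2_set (\<lambda>e. e m - e m') E < \<delta> \<Longrightarrow> m = m'"
    and locally_compact: "open U \<Longrightarrow> m \<in> U \<Longrightarrow>
      \<exists>V C. open V \<and> m \<in> V \<and> V \<subseteq> C \<and> compact C \<and> C \<subseteq> U"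
    and connected_UNIV: "connected (UNIV :: 'm set)"
begin

section \<open>The distance preserved by the flows\<close>

definition D :: "'m \<Rightarrow> 'm \<Rightarrow> real" where "D m m' = L2_set (\<lambda>e. e m - e m') E"

lemma D_nonneg: "D m m' \<ge> 0" by (simp add: D_def)

lemma D_sym: "D m m' = D m' m" by (simp add: D_def L2_set_def power2_commute)

lemma D_triangle: "D m m'' \<le> D m m' + D m' m''"
  using L2_set_triangle_ineq[of "\<lambda>e. e m - e m'" "\<lambda>e. e m' - e m''" E] by (simp add: D_def)

lemma D_eq_0_iff: "D m m' = 0 \<longleftrightarrow> m = m'"
  using separating_E by (auto simp: D_def L2_set_eq_0_iff[OF finite_E])

lemma cont_D: "continuous_on S (\<lambda>m. D m m')"
  unfolding D_def L2_set_def
  by (intro continuous_intros continuous_on_subset[OF cont_E]) auto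

lemma open_D_ball: "open {m. D m m' < r}"
  by (rule open_Collect_less) (auto intro: cont_D continuous_on_const)

lemma antisym_sum:
  assumes "f \<in> F" shows "(\<Sum>e\<in>E. \<Sum>j\<in>E. c f e j * (x e * x j)) = 0"
proof -
  have "(\<Sum>e\<in>E. \<Sum>j\<in>E. c f e j * (x e * x j)) = (\<Sum>j\<in>E. \<Sum>e\<in>E. c f e j * (x e * x j))"
    by (rule sum.swap)
  also have "\<dots> = (\<Sum>j\<in>E. \<Sum>e\<in>E. - (c f j e * (x j * x e)))"
    by (intro sum.cong refl) (subst antisym_c[OF assms], auto)
  also have "\<dots> = - (\<Sum>e\<in>E. \<Sum>j\<in>E. c f e j * (x e * x j))" by (simp add: sum_negf)
  finally show ?thesis by simp
qed

text \<open>The derivative of the squared distance is twice the quadratic form of \<open>c f\<close>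
  at the difference of the coordinate vectors, and the form of an antisymmetric matrix is
  zero.\<close>

lemma curve_isometry:
  assumes f: "f \<in> F" and g: "\<gamma> \<in> \<Gamma> f" "\<gamma>' \<in> \<Gamma> f"
  shows "D (\<gamma> t) (\<gamma>' t) = D (\<gamma> 0) (\<gamma>' 0)"
proof -
  define h where "h = (\<lambda>t. \<Sum>e\<in>E. (e (\<gamma> t) - e (\<gamma>' t))\<^sup>2)"
  have "(h has_real_derivative 0) (at t)" for t
  proof -
    have "(h has_real_derivative (\<Sum>e\<in>E. 2 * (e (\<gamma> t) - e (\<gamma>' t)) *
        ((\<Sum>j\<in>E. c f e j * j (\<gamma> t)) - (\<Sum>j\<in>E. c f e j * j (\<gamma>' t))))) (at t)"
      unfolding h_def
      by (rule DERIV_sum) (auto intro!: derivative_eq_intros curve_deriv[OF f] g)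
    moreover have "(\<Sum>e\<in>E. 2 * (e (\<gamma> t) - e (\<gamma>' t)) *
        ((\<Sum>j\<in>E. c f e j * j (\<gamma> t)) - (\<Sum>j\<in>E. c f e j * j (\<gamma>' t)))) =
      2 * (\<Sum>e\<in>E. \<Sum>j\<in>E. c f e j * ((e (\<gamma> t) - e (\<gamma>' t)) * (j (\<gamma> t) - j (\<gamma>' t))))"
      by (simp add: sum_subtractf[symmetric] sum_distrib_left algebra_simps)
    ultimately show ?thesis by (simp add: antisym_sum[OF f])
  qed
  then have "h t = h 0" by (intro DERIV_isconst_all) auto
  then show ?thesis by (simp add: D_def L2_set_def h_def)
qed

definition invariant :: "'m set \<Rightarrow> bool"
  where "invariant R \<longleftrightarrow> (\<forall>f\<in>F. \<forall>\<gamma>\<in>\<Gamma> f. \<forall>t. \<gamma> 0 \<in> R \<longrightarrow> \<gamma> t \<in> R)"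

text \<open>A point of \<open>R\<close> near \<open>m\<^sub>0\<close> at minimal distance from \<open>m\<close> is critical along all flows, so that
  the gap condition forces it to be \<open>m\<close>.\<close>

lemma near_point_in_invariant:
  assumes R: "closed R" "invariant R" "m\<^sub>0 \<in> R" and U: "open U" "m\<^sub>0 \<in> U"
  shows "\<exists>\<epsilon>>0. \<forall>m. D m m\<^sub>0 < \<epsilon> \<longrightarrow> m \<in> R \<inter> U"
proof -
  obtain V C where C: "open V" "m\<^sub>0 \<in> V" "V \<subseteq> C" "compact C" "C \<subseteq> U"
    using locally_compact[OF U] by blast
  \<comment> \<open>On the compact shell \<open>C - V\<close> the distance to
    \<open>m\<^sub>0\<close> has a positive minimum. This will force the minimiser \<open>x\<close>
    into the open set \<open>V\<close>, so that a curve through \<open>x\<close> stays in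
    \<open>C\<close> for a short time. An empty shell admits any \<open>\<eta>\<close>.\<close>
  have "\<exists>\<eta>>0. \<forall>m\<in>C - V. \<eta> \<le> D m m\<^sub>0"
  proof (cases "C - V = {}")
    case True
    then show ?thesis by (intro exI[of _ 1]) auto
  next
    case False
    have "compact (C - V)" using C by (auto intro: compact_diff)
    then obtain x where x: "x \<in> C - V" "\<And>m. m \<in> C - V \<Longrightarrow> D x m\<^sub>0 \<le> D m m\<^sub>0"
      using continuous_attains_inf[OF _ False cont_D[of _ m\<^sub>0]] by auto
    moreover have "D x m\<^sub>0 > 0" using x(1) C(2) D_eq_0_iff[of x m\<^sub>0] D_nonneg[of x m\<^sub>0] by auto
    ultimately show ?thesis by blast
  qed
  then obtain \<eta> where \<eta>: "\<eta> > 0" "\<And>m. m \<in> C - V \<Longrightarrow> \<eta> \<le> D m m\<^sub>0" by blast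
  \<comment> \<open>Half of \<open>\<eta>\<close>, because \<open>x\<close> is reached from
    \<open>m\<^sub>0\<close> through \<open>m\<close> by two steps shorter than
    \<open>\<epsilon>\<close>; at most \<open>\<delta>\<close>, for the gap condition.\<close>
  define \<epsilon> where "\<epsilon> = min (\<eta> / 2) \<delta>"
  have "m \<in> R \<inter> U" if m: "D m m\<^sub>0 < \<epsilon>" for m
  proof -
    have CR: "compact (C \<inter> R)" "C \<inter> R \<noteq> {}" using C R by (auto intro: compact_Int_closed)
    then obtain x where x: "x \<in> C \<inter> R" "\<And>y. y \<in> C \<inter> R \<Longrightarrow> D x m \<le> D y m"
      using continuous_attains_inf[OF CR cont_D[of _ m]] by auto
    \<comment> \<open>\<open>m\<^sub>0\<close> itself competes in the minimum.\<close>
    have xm: "D x m < \<epsilon>" using x(2)[of m\<^sub>0] C R m D_sym[of m m\<^sub>0] by auto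
    have "D x m\<^sub>0 < \<eta>" using D_triangle[of x m\<^sub>0 m] xm m by (simp add: \<epsilon>_def)
    then have xV: "x \<in> V" using \<eta>(2)[of x] x(1) by (meson DiffI IntD1 not_le)
    have "(\<Sum>e\<in>E. \<Sum>j\<in>E. c f e j * e m * j x) = 0" if f: "f \<in> F" for f
    proof -
      obtain \<gamma> where \<gamma>: "\<gamma> \<in> \<Gamma> f" "\<gamma> 0 = x" using curve_ex[OF f] by blast
      define h where "h = (\<lambda>t. \<Sum>e\<in>E. (e (\<gamma> t) - e m)\<^sup>2)"
      define h' where "h' = (\<Sum>e\<in>E. 2 * (e x - e m) * (\<Sum>j\<in>E. c f e j * j x))"
      have h': "(h has_real_derivative h') (at 0)"
        unfolding h_def h'_def
        by (rule DERIV_sum) (auto intro!: derivative_eq_intros curve_deriv[OF f] \<gamma> simp: \<gamma>(2))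
      have "open (\<gamma> -` V)" by (rule open_vimage[OF C(1) curve_cont[OF \<gamma>(1)]])
      moreover have "0 \<in> \<gamma> -` V" using \<gamma> xV by simp
      ultimately obtain r where r: "r > 0" "ball 0 r \<subseteq> \<gamma> -` V"
        using open_contains_ball by blast
      have "h 0 \<le> h t" if "\<bar>0 - t\<bar> < r" for t
      proof -
        have "t \<in> ball 0 r" using that by (simp add: dist_real_def)
        then have "\<gamma> t \<in> V" using r(2) by auto
        moreover have "\<gamma> t \<in> R" using R(2) f \<gamma> x(1) unfolding invariant_def by auto
        ultimately have "D x m \<le> D (\<gamma> t) m" using x(2) C(3) by blast
        then show ?thesis by (simp add: D_def L2_set_def h_def \<gamma>(2))
      qed
      then have "h' = 0" using DERIV_local_min[OF h' r(1)] by auto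
      \<comment> \<open>The minimum at time 0 makes \<open>h'\<close> zero. Of its two parts, the
        quadratic form at \<open>x\<close> vanishes by antisymmetry, which leaves the sum in the gap
        condition.\<close>
      moreover have "h' = 2 * ((\<Sum>e\<in>E. \<Sum>j\<in>E. c f e j * (e x * j x)) - (\<Sum>e\<in>E. \<Sum>j\<in>E. c f e j * e m * j x))"
        unfolding h'_def by (simp add: sum_subtractf[symmetric] sum_distrib_left algebra_simps)
      ultimately show ?thesis using antisym_sum[OF f, of "\<lambda>e. e x"] by simp
    qed
    moreover have "L2_set (\<lambda>e. e m - e x) E < \<delta>"
      using xm D_sym[of m x] by (simp add: D_def \<epsilon>_def)
    ultimately have "m = x" by (rule gap)
    then show ?thesis using x(1) C(5) by auto
  qed
  moreover have "\<epsilon> > 0" using \<eta>(1) gap_pos by (simp add: \<epsilon>_def)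
  ultimately show ?thesis by blast
qed

text \<open>\<open>near_point_in_invariant\<close> for the whole space puts a \<open>D\<close>-ball
  inside every neighbourhood, and \<open>D\<close>-balls are open because \<open>E\<close> consists
  of continuous functions. So continuity for \<open>D\<close> is continuity for the topology of
  \<open>'m\<close>.\<close>

lemma isometry_continuous:
  assumes "\<And>m m'. D (\<phi> m) (\<phi> m') = D m m'"
  shows "continuous_on UNIV \<phi>"
  unfolding continuous_on_topological
proof (intro ballI allI impI)
  fix m and U :: "'m set"
  assume "open U" "\<phi> m \<in> U"
  then obtain \<epsilon> where \<epsilon>: "\<epsilon> > 0" "\<And>x. D x (\<phi> m) < \<epsilon> \<Longrightarrow> x \<in> U"
    using near_point_in_invariant[of UNIV "\<phi> m" U] by (auto simp: invariant_def)
  show "\<exists>A. open A \<and> m \<in> A \<and> (\<forall>y\<in>UNIV. y \<in> A \<longrightarrow> \<phi> y \<in> U)"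
    using \<epsilon> assms D_eq_0_iff[of m m] by (intro exI[of _ "{x. D x m < \<epsilon>}"]) (auto simp: open_D_ball)
qed

section \<open>The group generated by the flows and its dense orbits\<close>

definition flow :: "'f \<Rightarrow> real \<Rightarrow> 'm \<Rightarrow> 'm"
  where "flow f t m = (SOME \<gamma>. \<gamma> \<in> \<Gamma> f \<and> \<gamma> 0 = m) t"

text \<open>Curves of \<open>f\<close> with the same start stay at distance 0, hence coincide. So
  the choice in \<open>flow\<close> is immaterial.\<close>

lemma flow_eq:
  assumes "f \<in> F" "\<gamma> \<in> \<Gamma> f" shows "flow f t (\<gamma> 0) = \<gamma> t"
proof -
  define \<gamma>' where "\<gamma>' = (SOME \<gamma>'. \<gamma>' \<in> \<Gamma> f \<and> \<gamma>' 0 = \<gamma> 0)"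
  have "\<gamma>' \<in> \<Gamma> f \<and> \<gamma>' 0 = \<gamma> 0"
    unfolding \<gamma>'_def by (rule someI[of _ \<gamma>]) (use assms in auto)
  then have "D (\<gamma>' t) (\<gamma> t) = 0"
    using curve_isometry[OF assms(1), of \<gamma>' \<gamma> t] assms D_eq_0_iff[of "\<gamma> 0" "\<gamma> 0"] by simp
  then have "\<gamma>' t = \<gamma> t" by (simp add: D_eq_0_iff)
  then show ?thesis by (simp add: flow_def \<gamma>'_def)
qed

lemma flow_isometry: assumes "f \<in> F" shows "D (flow f t m) (flow f t m') = D m m'"
proof -
  obtain \<gamma> \<gamma>' where "\<gamma> \<in> \<Gamma> f" "\<gamma>' \<in> \<Gamma> f" "\<gamma> 0 = m" "\<gamma>' 0 = m'"
    using curve_ex[OF assms] by meson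
  then show ?thesis
    using flow_eq[OF assms, of \<gamma>] flow_eq[OF assms, of \<gamma>'] curve_isometry[OF assms, of \<gamma> \<gamma>'] by auto
qed

text \<open>The flow for time \<open>- t\<close> is a right inverse, as the curve restarted at
  \<open>- t\<close> is again a curve of \<open>f\<close>.\<close>

lemma flow_surj: assumes "f \<in> F" shows "surj (flow f t)"
proof (rule surjI)
  fix m
  obtain \<gamma> where \<gamma>: "\<gamma> \<in> \<Gamma> f" "\<gamma> 0 = m" using curve_ex[OF assms] by meson
  have "flow f (- t) m = \<gamma> (- t)" using flow_eq[OF assms \<gamma>(1), of "- t"] \<gamma>(2) by simp
  then show "flow f t (flow f (- t) m) = m"
    using flow_eq[OF assms curve_shift[OF \<gamma>(1), of "- t"], of t] \<gamma>(2) by simp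
qed

text \<open>Words in the flows; negative times supply the inverses, so this is the group that they
  generate.\<close>

inductive_set G :: "('m \<Rightarrow> 'm) set" where
  id: "id \<in> G"
| comp: "\<phi> \<in> G \<Longrightarrow> f \<in> F \<Longrightarrow> flow f t \<circ> \<phi> \<in> G"

lemma G_isometry: "\<phi> \<in> G \<Longrightarrow> D (\<phi> m) (\<phi> m') = D m m'"
  by (induction rule: G.induct) (auto simp: flow_isometry)

lemma G_surj: "\<phi> \<in> G \<Longrightarrow> surj \<phi>"
  by (induction rule: G.induct) (simp_all only: surj_id comp_surj flow_surj)

text \<open>Each flow maps the orbit into itself and, being an isometry, is continuous; so it maps
  the closure into itself.\<close>

lemma invariant_closure_orbit: "invariant (closure ((\<lambda>\<phi>. \<phi> m) ` G))"
  unfolding invariant_def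
proof (intro ballI allI impI)
  fix f \<gamma> t
  assume f: "f \<in> F" "\<gamma> \<in> \<Gamma> f" and g0: "\<gamma> 0 \<in> closure ((\<lambda>\<phi>. \<phi> m) ` G)"
  have "flow f t ` closure ((\<lambda>\<phi>. \<phi> m) ` G) \<subseteq> closure ((\<lambda>\<phi>. \<phi> m) ` G)"
  proof (rule image_closure_subset)
    show "continuous_on (closure ((\<lambda>\<phi>. \<phi> m) ` G)) (flow f t)"
      using isometry_continuous[OF flow_isometry[OF f(1)]] by (rule continuous_on_subset) simp
    show "flow f t ` (\<lambda>\<phi>. \<phi> m) ` G \<subseteq> closure ((\<lambda>\<phi>. \<phi> m) ` G)"
    proof clarify
      fix \<phi> assume "\<phi> \<in> G"
      then have "(flow f t \<circ> \<phi>) m \<in> (\<lambda>\<phi>. \<phi> m) ` G" by (intro imageI G.comp f(1))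
      then show "flow f t (\<phi> m) \<in> closure ((\<lambda>\<phi>. \<phi> m) ` G)"
        using closure_subset[THEN subsetD] by simp
    qed
  qed simp
  then show "\<gamma> t \<in> closure ((\<lambda>\<phi>. \<phi> m) ` G)" using g0 flow_eq[OF f, of t] by auto
qed

text \<open>The closure is closed and invariant, so by \<open>near_point_in_invariant\<close> it
  contains a \<open>D\<close>-ball around each of its points. It is thus open as well, and
  connectedness applies.\<close>

lemma orbit_dense: "closure ((\<lambda>\<phi>. \<phi> m) ` G) = UNIV"
proof -
  define R where "R = closure ((\<lambda>\<phi>. \<phi> m) ` G)"
  have R: "closed R" "invariant R" using invariant_closure_orbit by (auto simp: R_def)
  have "open R"
  proof (subst open_subopen, intro ballI)
    fix x assume "x \<in> R"
    then obtain \<epsilon> where "\<epsilon> > 0" "\<And>y. D y x < \<epsilon> \<Longrightarrow> y \<in> R"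
      using near_point_in_invariant[OF R, of x UNIV] by auto
    then show "\<exists>T. open T \<and> x \<in> T \<and> T \<subseteq> R"
      using D_eq_0_iff[of x x] by (intro exI[of _ "{y. D y x < \<epsilon>}"]) (auto simp: open_D_ball)
  qed
  moreover have "m \<in> R"
  proof -
    have "m \<in> (\<lambda>\<phi>. \<phi> m) ` G" using G.id by (metis id_apply imageI)
    then show ?thesis unfolding R_def by (rule closure_subset[THEN subsetD])
  qed
  ultimately have "R = UNIV"
    using connected_UNIV R(1) connected_clopen[of "UNIV :: 'm set"] by auto
  then show ?thesis by (simp add: R_def)
qed

text \<open>The coordinates are bounded by \<open>sqrt N\<close>, so rounding them to a grid of step
  \<open>\<eta>\<close> gives finitely many cells; one representative of each occupied cell is
  kept.\<close>

lemma finite_net: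
  assumes "\<epsilon> > 0" shows "\<exists>S. finite S \<and> (\<forall>m. \<exists>s\<in>S. D m s < \<epsilon>)"
proof -
  \<comment> \<open>Chosen so that \<open>card E * \<eta> < \<epsilon>\<close>; the added 1 keeps
    the denominator positive for empty \<open>E\<close>.\<close>
  define \<eta> where "\<eta> = \<epsilon> / (2 * (real (card E) + 1))"
  have \<eta>: "\<eta> > 0" using assms by (simp add: \<eta>_def)
  define q where "q = (\<lambda>m. restrict (\<lambda>e. \<lfloor>e m / \<eta>\<rfloor>) E)"
  have "\<bar>e m\<bar> \<le> sqrt N" if "e \<in> E" for e m
  proof -
    have "(e m)\<^sup>2 \<le> (\<Sum>e\<in>E. (e m)\<^sup>2)" using that finite_E by (intro member_le_sum) auto
    then have "\<bar>e m\<bar>\<^sup>2 \<le> N" using bounded_E[of m] by simp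
    then show ?thesis by (rule real_le_rsqrt)
  qed
  then have "\<bar>e m / \<eta>\<bar> \<le> sqrt N / \<eta>" if "e \<in> E" for e m
    using that \<eta> by (simp add: divide_right_mono)
  from this[THEN abs_le_D1] this[THEN abs_le_D2, THEN le_imp_neg_le]
  have "- (sqrt N / \<eta>) \<le> e m / \<eta> \<and> e m / \<eta> \<le> sqrt N / \<eta>" if "e \<in> E" for e m
    using that by (simp only: minus_minus simp_thms)
  then have "q m \<in> E \<rightarrow>\<^sub>E {\<lfloor>- (sqrt N / \<eta>)\<rfloor>..\<lfloor>sqrt N / \<eta>\<rfloor>}" for m
    by (auto simp: q_def PiE_def extensional_def intro!: floor_mono)
  then have "range q \<subseteq> (E \<rightarrow>\<^sub>E {\<lfloor>- (sqrt N / \<eta>)\<rfloor>..\<lfloor>sqrt N / \<eta>\<rfloor>})" by blast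
  then have "finite (range q)"
    by (rule finite_subset) (intro finite_PiE finite_E finite_atLeastAtMost_int)
  moreover have "\<exists>s\<in>inv_into UNIV q ` range q. D m s < \<epsilon>" for m
  proof -
    define s where "s = inv_into UNIV q (q m)"
    have s: "q s = q m" unfolding s_def by (rule f_inv_into_f) simp
    have "\<bar>e m - e s\<bar> \<le> \<eta>" if "e \<in> E" for e
    proof -
      have "\<lfloor>e m / \<eta>\<rfloor> = \<lfloor>e s / \<eta>\<rfloor>" using fun_cong[OF s, of e] that by (simp add: q_def)
      then have "\<bar>e m / \<eta> - e s / \<eta>\<bar> \<le> 1" by linarith
      then show ?thesis using \<eta> by (simp add: diff_divide_distrib[symmetric])
    qed
    then have "D m s \<le> (\<Sum>e\<in>E. \<eta>)"
      unfolding D_def by (intro order_trans[OF L2_set_le_sum_abs] sum_mono) auto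
    also have "\<dots> < \<epsilon>" using assms by (simp add: \<eta>_def field_simps add_nonneg_pos)
    finally show ?thesis by (auto simp: s_def)
  qed
  ultimately show ?thesis by (metis finite_imageI)
qed

theorem compact_UNIV: "compact (UNIV :: 'm set)"
proof -
  define m\<^sub>0 :: 'm where "m\<^sub>0 = undefined"
  obtain V C where C: "open V" "m\<^sub>0 \<in> V" "V \<subseteq> C" "compact C"
    using locally_compact[of UNIV m\<^sub>0] by auto
  obtain \<epsilon> where \<epsilon>: "\<epsilon> > 0" "\<And>m. D m m\<^sub>0 < \<epsilon> \<Longrightarrow> m \<in> C"
    using near_point_in_invariant[of UNIV m\<^sub>0 V] C by (auto simp: invariant_def)
  obtain S where S: "finite S" "\<And>m. \<exists>s\<in>S. D m s < \<epsilon> / 2"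
    using finite_net[of "\<epsilon> / 2"] \<epsilon>(1) by auto
  have "\<exists>\<phi>\<in>G. D (\<phi> m\<^sub>0) s < \<epsilon> / 2" for s
  proof (rule ccontr)
    assume "\<not> ?thesis"
    then have "{m. D m s < \<epsilon> / 2} \<inter> (\<lambda>\<phi>. \<phi> m\<^sub>0) ` G = {}" by auto
    then have "{m. D m s < \<epsilon> / 2} \<inter> UNIV = {}"
      using open_Int_closure_eq_empty[OF open_D_ball] orbit_dense by metis
    moreover have "s \<in> {m. D m s < \<epsilon> / 2}" using D_eq_0_iff[of s s] \<epsilon>(1) by simp
    ultimately show False by blast
  qed
  then obtain \<phi> where \<phi>: "\<And>s. \<phi> s \<in> G" "\<And>s. D (\<phi> s m\<^sub>0) s < \<epsilon> / 2" by metis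
  have "m \<in> (\<Union>s\<in>S. \<phi> s ` C)" for m
  proof -
    obtain s where s: "s \<in> S" "D m s < \<epsilon> / 2" using S(2) by blast
    obtain n where n: "m = \<phi> s n" using G_surj[OF \<phi>(1)] by blast
    have "D n m\<^sub>0 = D m (\<phi> s m\<^sub>0)" using G_isometry[OF \<phi>(1)] n by simp
    also have "\<dots> < \<epsilon>" using D_triangle[of m "\<phi> s m\<^sub>0" s] s(2) \<phi>(2)[of s] D_sym[of s "\<phi> s m\<^sub>0"] by simp
    finally show ?thesis using \<epsilon>(2) n s(1) by blast
  qed
  then have "(UNIV :: 'm set) = (\<Union>s\<in>S. \<phi> s ` C)" by blast
  moreover have "compact (\<phi> s ` C)" for s
    using isometry_continuous[OF G_isometry[OF \<phi>(1)]] C(4)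
    by (auto intro: compact_continuous_image continuous_on_subset)
  ultimately show ?thesis using compact_UN[OF S(1)] by metis
qed

end

section \<open>Smooth functions and integral curves\<close>

lemma charts_at_nonempty:
  assumes "smooth_atlas A" shows "\<exists>c. c \<in> charts_at A m"
  using assms unfolding smooth_atlas_def charts_at_def by blast

context
  fixes A :: "('m::{t2_space,second_countable_topology}, 'e::euclidean_space) chart set" and c
  assumes atlas: "smooth_atlas A" and c: "c \<in> A"
begin

lemma chart_open: "open (fst c)" "open (snd c ` fst c)"
  and chart_homeomorphism: "homeomorphism (fst c) (snd c ` fst c) (snd c) (chart_inv c)"
  using atlas c unfolding smooth_atlas_def by auto

lemma chart_inv_apply: "m \<in> fst c \<Longrightarrow> chart_inv c (snd c m) = m"
  using chart_homeomorphism by (simp add: homeomorphism_def)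

lemma chart_cont: "continuous_on (fst c) (snd c)" "continuous_on (snd c ` fst c) (chart_inv c)"
  using chart_homeomorphism by (auto simp: homeomorphism_def)

lemma open_chart_vimage: assumes "open W" shows "open {m \<in> fst c. snd c m \<in> W}"
proof -
  have "{m \<in> fst c. snd c m \<in> W} = fst c \<inter> snd c -` W" by auto
  then show ?thesis using continuous_open_preimage[OF chart_cont(1) chart_open(1) assms] by simp
qed

end

lemma smooth_on_differentiable:
  assumes "smooth_on f S" "x \<in> S" shows "f differentiable (at x)"
  using assms unfolding smooth_on_def by (metis Ck_on.simps(2))

lemma smooth_functions_differentiable:
  assumes "f \<in> smooth_functions A" "c \<in> A" "x \<in> snd c ` fst c"
  shows "(f \<circ> chart_inv c) differentiable (at x)"
  using assms by (auto simp: smooth_functions_def intro: smooth_on_differentiable)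

lemma smooth_functions_continuous:
  fixes A :: "('m::{t2_space,second_countable_topology}, 'e::euclidean_space) chart set"
  assumes A: "smooth_atlas A" and f: "f \<in> smooth_functions A"
  shows "continuous_on UNIV f"
proof -
  have "continuous_on (fst c) f" if c: "c \<in> A" for c
  proof -
    have "continuous_on (snd c ` fst c) (f \<circ> chart_inv c)"
      using smooth_functions_differentiable[OF f c]
      by (intro continuous_at_imp_continuous_on ballI differentiable_imp_continuous_within)
    from continuous_on_compose[OF chart_cont(1)[OF A c] this]
    have "continuous_on (fst c) (\<lambda>m. f (chart_inv c (snd c m)))" by (simp add: comp_def)
    then show ?thesis by (rule continuous_on_eq) (simp add: chart_inv_apply[OF A c])
  qed
  then have "continuous_on (\<Union>c\<in>A. fst c) f"
    using chart_open(1)[OF A] by (intro continuous_on_open_UN) auto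
  then show ?thesis using A by (simp add: smooth_atlas_def)
qed

lemma atlas_locally_compact:
  fixes A :: "('m::{t2_space,second_countable_topology}, 'e::euclidean_space) chart set" and m :: 'm
  assumes A: "smooth_atlas A" and U: "open U" "m \<in> U"
  shows "\<exists>V C. open V \<and> m \<in> V \<and> V \<subseteq> C \<and> compact C \<and> C \<subseteq> U"
proof -
  obtain c where c: "c \<in> A" "m \<in> fst c"
    using charts_at_nonempty[OF A, of m] by (auto simp: charts_at_def)
  define W where "W = snd c ` fst c \<inter> chart_inv c -` U"
  have "open W" unfolding W_def
    by (rule continuous_open_preimage[OF chart_cont(2)[OF A c(1)] chart_open(2)[OF A c(1)] U(1)])
  moreover have "snd c m \<in> W" using c U by (simp add: W_def chart_inv_apply[OF A])
  ultimately obtain r where r: "r > 0" "cball (snd c m) r \<subseteq> W" using open_contains_cball by blast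
  define V where "V = {y \<in> fst c. snd c y \<in> ball (snd c m) r}"
  have "open V" unfolding V_def by (rule open_chart_vimage[OF A c(1)]) simp
  moreover have "m \<in> V" using c r by (simp add: V_def)
  moreover have "V \<subseteq> chart_inv c ` cball (snd c m) r"
  proof
    fix y assume "y \<in> V"
    then have "y = chart_inv c (snd c y)" "snd c y \<in> cball (snd c m) r"
      using chart_inv_apply[OF A c(1)] by (auto simp: V_def)
    then show "y \<in> chart_inv c ` cball (snd c m) r" by (rule image_eqI)
  qed
  moreover have "compact (chart_inv c ` cball (snd c m) r)"
    using r(2) by (intro compact_continuous_image compact_cball continuous_on_subset[OF chart_cont(2)[OF A c(1)]])
      (auto simp: W_def)
  moreover have "chart_inv c ` cball (snd c m) r \<subseteq> U" using r(2) by (auto simp: W_def)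
  ultimately show ?thesis by blast
qed

text \<open>The chain rule in the chart \<open>c\<close>: by continuity the curve stays in its
  domain near \<open>t\<close>. The target of \<open>g\<close> is a general normed space because
  complex traces are differentiated later.\<close>

lemma integral_curve_derivative:
  fixes A :: "('m::{t2_space,second_countable_topology}, 'e::euclidean_space) chart set"
    and g :: "'m \<Rightarrow> 'b::real_normed_vector"
  assumes A: "smooth_atlas A" and \<gamma>: "integral_curve A X \<gamma>" and c: "c \<in> charts_at A (\<gamma> t)"
    and g: "(g \<circ> chart_inv c) differentiable (at (snd c (\<gamma> t)))"
  shows "((\<lambda>s. g (\<gamma> s)) has_vector_derivative
    frechet_derivative (g \<circ> chart_inv c) (at (snd c (\<gamma> t))) (X (\<gamma> t) c)) (at t)"
proof -
  define d where "d = frechet_derivative (g \<circ> chart_inv c) (at (snd c (\<gamma> t)))"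
  have cA: "c \<in> A" "\<gamma> t \<in> fst c" using c by (auto simp: charts_at_def)
  have d: "((g \<circ> chart_inv c) has_derivative d) (at ((snd c \<circ> \<gamma>) t))"
    using g by (simp add: d_def frechet_derivative_works)
  have "((snd c \<circ> \<gamma>) has_derivative (\<lambda>h. h *\<^sub>R X (\<gamma> t) c)) (at t)"
    using \<gamma> c by (simp add: integral_curve_def has_vector_derivative_def)
  from diff_chain_at[OF this d]
  have 1: "((\<lambda>s. g (chart_inv c (snd c (\<gamma> s)))) has_derivative (\<lambda>h. d (h *\<^sub>R X (\<gamma> t) c))) (at t)"
    by (simp add: comp_def)
  have "open (\<gamma> -` fst c)"
    using \<gamma> chart_open(1)[OF A cA(1)] by (auto simp: integral_curve_def intro: open_vimage)
  from has_derivative_transform_within_open[OF 1 this, of "\<lambda>s. g (\<gamma> s)"]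
  have "((\<lambda>s. g (\<gamma> s)) has_derivative (\<lambda>h. d (h *\<^sub>R X (\<gamma> t) c))) (at t)"
    using cA chart_inv_apply[OF A cA(1)] by auto
  moreover have "linear d" using d by (rule has_derivative_linear)
  ultimately show ?thesis by (simp add: has_vector_derivative_def d_def linear_scale)
qed

lemma integral_curve_poisson_bracket:
  fixes A :: "('m::{t2_space,second_countable_topology}, 'e::euclidean_space) chart set"
  assumes A: "smooth_atlas A" and \<gamma>: "integral_curve A (hamiltonian_vf A \<omega> f) \<gamma>"
    and g: "g \<in> smooth_functions A"
  shows "((\<lambda>s. g (\<gamma> s)) has_real_derivative poisson_bracket A \<omega> f g (\<gamma> t)) (at t)"
proof -
  \<comment> \<open>The chart that \<open>differential\<close> selects at this point, so that both
    sides contain the same derivative.\<close>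
  define c where "c = (SOME c. c \<in> charts_at A (\<gamma> t))"
  have c: "c \<in> charts_at A (\<gamma> t)"
    unfolding c_def using charts_at_nonempty[OF A] by (rule someI_ex)
  then have "(g \<circ> chart_inv c) differentiable (at (snd c (\<gamma> t)))"
    using smooth_functions_differentiable[OF g] by (auto simp: charts_at_def)
  from integral_curve_derivative[OF A \<gamma> c this] show ?thesis
    by (simp add: poisson_bracket_def differential_def Let_def c_def has_real_derivative_iff_has_vector_derivative)
qed

lemma integral_curve_shift:
  assumes "integral_curve A X \<gamma>" shows "integral_curve A X (\<lambda>t. \<gamma> (s + t))"
  unfolding integral_curve_def
proof (intro conjI allI ballI)
  have "continuous_on UNIV \<gamma>" using assms by (simp add: integral_curve_def)
  then show "continuous_on UNIV (\<lambda>t. \<gamma> (s + t))"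
    by (rule continuous_on_compose2) (auto intro!: continuous_intros)
next
  fix t c assume c: "c \<in> charts_at A (\<gamma> (s + t))"
  have "((\<lambda>t. s + t) has_vector_derivative 1) (at t)" by (auto intro!: derivative_eq_intros)
  moreover have "((snd c \<circ> \<gamma>) has_vector_derivative X (\<gamma> (s + t)) c) (at (s + t))"
    using assms c by (simp add: integral_curve_def)
  ultimately show "(snd c \<circ> (\<lambda>t. \<gamma> (s + t)) has_vector_derivative X (\<gamma> (s + t)) c) (at t)"
    using vector_diff_chain_at[of "\<lambda>t. s + t" 1 t "snd c \<circ> \<gamma>"] by (simp add: comp_def)
qed

section \<open>Tangent vectors and first integrals\<close>

lemma transition_differentiable:
  fixes A :: "('m::{t2_space,second_countable_topology}, 'e::euclidean_space) chart set"
  assumes A: "smooth_atlas A" and "c \<in> charts_at A m" "c' \<in> charts_at A m"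
  shows "transition c c' differentiable (at (snd c m))"
proof -
  have "smooth_on (transition c c') (snd c ` (fst c \<inter> fst c'))"
    using assms by (auto simp: smooth_atlas_def charts_at_def)
  then show ?thesis using assms by (auto simp: charts_at_def intro: smooth_on_differentiable)
qed

text \<open>The chain rule: near \<open>snd c m\<close>, on the open set \<open>W\<close> of points
  that \<open>c'\<close> also covers, \<open>transition c c''\<close> factors through
  \<open>c'\<close>.\<close>

lemma transition_derivative_comp:
  fixes A :: "('m::{t2_space,second_countable_topology}, 'e::euclidean_space) chart set"
  assumes A: "smooth_atlas A"
    and c: "c \<in> charts_at A m" "c' \<in> charts_at A m" "c'' \<in> charts_at A m"
  shows "frechet_derivative (transition c c'') (at (snd c m)) =
    frechet_derivative (transition c' c'') (at (snd c' m)) \<circ> frechet_derivative (transition c c') (at (snd c m))"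
proof -
  have cA: "c \<in> A" "m \<in> fst c" "c' \<in> A" "m \<in> fst c'" using c by (auto simp: charts_at_def)
  have m: "transition c c' (snd c m) = snd c' m"
    by (simp add: transition_def chart_inv_apply[OF A] cA)
  have 1: "(transition c c' has_derivative frechet_derivative (transition c c') (at (snd c m))) (at (snd c m))"
    and 2: "(transition c' c'' has_derivative frechet_derivative (transition c' c'') (at (snd c' m)))
      (at (transition c c' (snd c m)))"
    using transition_differentiable[OF A] c by (auto simp: m frechet_derivative_works)
  define W where "W = snd c ` fst c \<inter> chart_inv c -` fst c'"
  have "open W" unfolding W_def
    by (rule continuous_open_preimage[OF chart_cont(2)[OF A cA(1)] chart_open(2)[OF A cA(1)] chart_open(1)[OF A cA(3)]])
  moreover have "snd c m \<in> W" using cA by (simp add: W_def chart_inv_apply[OF A])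
  moreover have "(transition c' c'' \<circ> transition c c') x = transition c c'' x" if "x \<in> W" for x
    using that by (auto simp: transition_def W_def chart_inv_apply[OF A cA(3)])
  ultimately have "(transition c c'' has_derivative frechet_derivative (transition c' c'') (at (snd c' m)) \<circ>
      frechet_derivative (transition c c') (at (snd c m))) (at (snd c m))"
    using has_derivative_transform_within_open[OF diff_chain_at[OF 1 2]] by blast
  then show ?thesis by (rule frechet_derivative_at[symmetric])
qed

lemma transition_self_derivative:
  fixes A :: "('m::{t2_space,second_countable_topology}, 'e::euclidean_space) chart set"
  assumes A: "smooth_atlas A" and c: "c \<in> charts_at A m"
  shows "frechet_derivative (transition c c) (at (snd c m)) = (\<lambda>u. u)"
proof -
  have cA: "c \<in> A" "m \<in> fst c" using c by (auto simp: charts_at_def)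
  have "(transition c c has_derivative (\<lambda>u. u)) (at (snd c m))"
  proof (rule has_derivative_transform_within_open[OF has_derivative_ident chart_open(2)[OF A cA(1)]])
    show "x = transition c c x" if "x \<in> snd c ` fst c" for x
      using that chart_inv_apply[OF A cA(1)] by (auto simp: transition_def)
  qed (use cA in auto)
  then show ?thesis by (rule frechet_derivative_at[symmetric])
qed

text \<open>The cocycle rule for transition derivatives makes the components compatible. Hence every
  \<open>u\<close> is the component in \<open>c\<close> of some tangent vector.\<close>

lemma coord_vector_tangent:
  fixes A :: "('m::{t2_space,second_countable_topology}, 'e::euclidean_space) chart set"
  assumes A: "smooth_atlas A" and c: "c \<in> charts_at A m"
  shows "coord_vector A c u m \<in> tangent_space A m" "coord_vector A c u m c = u"
proof -
  show "coord_vector A c u m \<in> tangent_space A m"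
    unfolding tangent_space_def mem_Collect_eq
  proof (intro conjI allI impI ballI)
    fix c' c'' assume c': "c' \<in> charts_at A m" "c'' \<in> charts_at A m"
    show "coord_vector A c u m c'' =
        frechet_derivative (transition c' c'') (at (snd c' m)) (coord_vector A c u m c')"
      using fun_cong[OF transition_derivative_comp[OF A c c'], of u] c' by (simp add: coord_vector_def)
  qed (simp add: coord_vector_def)
  show "coord_vector A c u m c = u"
    by (simp add: coord_vector_def c transition_self_derivative[OF A])
qed

text \<open>Completeness provides a curve in the direction of each Hamiltonian vector, so the
  derivative of \<open>h\<close> kills these vectors. By transitivity they span the tangent space,
  so \<open>h\<close> has zero derivative in every chart, is locally constant, and connectedness
  concludes.\<close>

lemma first_integral_constant:
  fixes A :: "('m::{t2_space,second_countable_topology}, 'e::euclidean_space) chart set"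
    and h :: "'m \<Rightarrow> 'b::real_normed_vector"
  assumes A: "smooth_atlas A" and conn: "connected (UNIV :: 'm set)"
    and b: "transitive A \<omega> b" "complete_fields A \<omega> b"
    and diff: "\<And>c x. c \<in> A \<Longrightarrow> x \<in> snd c ` fst c \<Longrightarrow> (h \<circ> chart_inv c) differentiable (at x)"
    and h: "\<And>f \<gamma>. f \<in> b \<Longrightarrow> integral_curve A (hamiltonian_vf A \<omega> f) \<gamma> \<Longrightarrow>
      ((\<lambda>t. h (\<gamma> t)) has_vector_derivative 0) (at 0)"
  shows "h m = h m'"
proof (rule connected_local_const[OF conn])
  have deriv0: "((h \<circ> chart_inv c) has_derivative (\<lambda>_. 0)) (at (snd c m))" if c: "c \<in> charts_at A m" for c m
  proof -
    define d where "d = frechet_derivative (h \<circ> chart_inv c) (at (snd c m))"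
    have df: "(h \<circ> chart_inv c) differentiable (at (snd c m))"
      using diff c by (auto simp: charts_at_def)
    then have d: "((h \<circ> chart_inv c) has_derivative d) (at (snd c m))"
      by (simp add: d_def frechet_derivative_works)
    interpret d: linear d using d by (rule has_derivative_linear)
    have "d (hamiltonian_vf A \<omega> f m c) = 0" if f: "f \<in> b" for f
    proof -
      obtain \<gamma> where \<gamma>: "\<gamma> 0 = m" "integral_curve A (hamiltonian_vf A \<omega> f) \<gamma>"
        using b(2) f unfolding complete_fields_def complete_vector_field_def by blast
      have "((\<lambda>t. h (\<gamma> t)) has_vector_derivative d (hamiltonian_vf A \<omega> f m c)) (at 0)"
        using integral_curve_derivative[OF A \<gamma>(2), of c 0 h] c df \<gamma>(1) by (simp add: d_def)
      then show ?thesis using h[OF f \<gamma>(2)] by (rule vector_derivative_unique_at)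
    qed
    then have "(\<lambda>f. hamiltonian_vf A \<omega> f m) ` b \<subseteq> {v. d (v c) = 0}" by auto
    moreover have "subspace {v :: ('m, 'e) tangent. d (v c) = 0}"
      by (rule subspaceI) (auto simp: d.zero d.add d.scale plus_fun_def zero_fun_def scaleR_fun_def)
    ultimately have "tangent_space A m \<subseteq> {v. d (v c) = 0}"
      using b(1) span_minimal unfolding transitive_def by blast
    then have "d u = 0" for u using coord_vector_tangent[OF A c, of u] by auto
    then have "d = (\<lambda>_. 0)" by auto
    with d show ?thesis by simp
  qed
  show "\<forall>m\<in>UNIV. eventually (\<lambda>y. h m = h y) (at m)"
  proof
    fix m
    obtain c where c: "c \<in> A" "m \<in> fst c"
      using charts_at_nonempty[OF A, of m] by (auto simp: charts_at_def)
    obtain r where r: "r > 0" "ball (snd c m) r \<subseteq> snd c ` fst c"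
      using chart_open(2)[OF A c(1)] c(2) open_contains_ball by blast
    have "\<exists>k. \<forall>x\<in>ball (snd c m) r. (h \<circ> chart_inv c) x = k"
    proof (rule has_derivative_zero_constant)
      fix x assume "x \<in> ball (snd c m) r"
      then obtain y where "y \<in> fst c" "x = snd c y" using r(2) by blast
      then have "((h \<circ> chart_inv c) has_derivative (\<lambda>_. 0)) (at x)"
        using deriv0[of c y] c(1) by (simp add: charts_at_def)
      then show "((h \<circ> chart_inv c) has_derivative (\<lambda>_. 0)) (at x within ball (snd c m) r)"
        by (rule has_derivative_at_withinI)
    qed simp
    then obtain k where k: "\<And>x. x \<in> ball (snd c m) r \<Longrightarrow> h (chart_inv c x) = k" by auto
    have hk: "h y = k" if "y \<in> fst c" "snd c y \<in> ball (snd c m) r" for y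
      using k[OF that(2)] chart_inv_apply[OF A c(1) that(1)] by simp
    then have "h m = k" using c(2) r(1) by simp
    with hk show "eventually (\<lambda>y. h m = h y) (at m)"
      unfolding eventually_at_topological using c(2) r(1) open_chart_vimage[OF A c(1) open_ball]
      by (intro exI[of _ "{y \<in> fst c. snd c y \<in> ball (snd c m) r}"]) auto
  qed
qed auto

section \<open>The moment map in operator form\<close>

locale observables_rep = complex_onb cscale ip B
  for cscale :: "complex \<Rightarrow> 'h::ab_group_add \<Rightarrow> 'h" and ip and B +
  fixes A :: "('m::{t2_space,second_countable_topology}, 'e::euclidean_space) chart set"
    and \<omega> :: "('m, 'e) two_tensor" and b :: "('m \<Rightarrow> real) set" and hbar :: real
    and \<rho> :: "('m \<Rightarrow> real) \<Rightarrow> 'h \<Rightarrow> 'h"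
  assumes atlas: "smooth_atlas A" and connected_M: "connected (UNIV :: 'm set)"
    and hbar_pos: "hbar > 0"
    and observables: "observables_B1_B3 A \<omega> b"
    and fin_dim_b: "finite_dimensional b"
    and rep: "faithful_symmetric_representation A \<omega> hbar b cscale ip \<rho>"
begin

section \<open>The representation and its invariant trace form\<close>

abbreviation bracket :: "('m \<Rightarrow> real) \<Rightarrow> ('m \<Rightarrow> real) \<Rightarrow> 'm \<Rightarrow> real"
  where "bracket \<equiv> poisson_bracket A \<omega>"

lemma b_smooth: "f \<in> b \<Longrightarrow> f \<in> smooth_functions A"
  and b_subspace: "Real_Vector_Spaces.subspace b"
  and b_bracket: "f \<in> b \<Longrightarrow> g \<in> b \<Longrightarrow> bracket f g \<in> b"
  and b_complete: "complete_fields A \<omega> b"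
  and b_transitive: "transitive A \<omega> b"
  and b_separating: "separating b"
  using observables by (auto simp: observables_B1_B3_def lie_subalgebra_def)

lemma rho_sym: "f \<in> b \<Longrightarrow> sym (\<rho> f)"
  and rho_add: "f \<in> b \<Longrightarrow> g \<in> b \<Longrightarrow> \<rho> (f + g) x = \<rho> f x + \<rho> g x"
  and rho_scale: "f \<in> b \<Longrightarrow> \<rho> (r *\<^sub>R f) x = cscale (complex_of_real r) (\<rho> f x)"
  and rho_inj: "inj_on \<rho> b"
  and rho_bracket: "f \<in> b \<Longrightarrow> g \<in> b \<Longrightarrow>
    \<rho> (bracket f g) x = cscale (\<i> / complex_of_real hbar) (\<rho> f (\<rho> g x) - \<rho> g (\<rho> f x))"
  using rep by (auto simp: faithful_symmetric_representation_def)

lemma rho_lin: "f \<in> b \<Longrightarrow> lin (\<rho> f)"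
  using rho_sym symD(1) by blast

lemma rho_0: "\<rho> 0 x = 0"
  using rho_scale[OF real_vector.subspace_0[OF b_subspace], of 0 x] by simp

lemma b_sum: "(\<And>i. i \<in> I \<Longrightarrow> g i \<in> b) \<Longrightarrow> (\<Sum>i\<in>I. u i *\<^sub>R g i) \<in> b"
  by (intro real_vector.subspace_sum[OF b_subspace] real_vector.subspace_scale[OF b_subspace]) auto

lemma rho_sum:
  assumes "finite I" "\<And>i. i \<in> I \<Longrightarrow> g i \<in> b"
  shows "\<rho> (\<Sum>i\<in>I. u i *\<^sub>R g i) x = (\<Sum>i\<in>I. cscale (complex_of_real (u i)) (\<rho> (g i) x))"
  using assms
proof induction
  case (insert a I)
  have ga: "g a \<in> b" and s: "(\<Sum>i\<in>I. u i *\<^sub>R g i) \<in> b"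
    using insert.prems by (auto intro: b_sum)
  show ?case
    using rho_add[OF real_vector.subspace_scale[OF b_subspace ga] s] insert.IH insert.prems
    unfolding sum.insert[OF insert.hyps] by (simp only: rho_scale[OF ga] insert_iff simp_thms)
qed (simp only: sum.empty rho_0)

text \<open>On \<open>b\<close> this is \<open>Re (tr (\<rho> f \<circ> \<rho> g))\<close>, with the
  symmetric \<open>\<rho> f\<close> moved to the left: the real Hilbert-Schmidt inner product pulled
  back along \<open>\<rho>\<close>.\<close>

definition bip :: "('m \<Rightarrow> real) \<Rightarrow> ('m \<Rightarrow> real) \<Rightarrow> real"
  where "bip f g = (\<Sum>e\<in>B. Re (ip (\<rho> f e) (\<rho> g e)))"

lemma bip_add: "f \<in> b \<Longrightarrow> g \<in> b \<Longrightarrow> h \<in> b \<Longrightarrow> bip f (g + h) = bip f g + bip f h"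
  by (simp add: bip_def rho_add ip_add sum.distrib)

lemma bip_scale: "f \<in> b \<Longrightarrow> g \<in> b \<Longrightarrow> bip f (r *\<^sub>R g) = r * bip f g"
  by (simp add: bip_def rho_scale ip_scale sum_distrib_left)

lemma bip_sym: "bip f g = bip g f"
  unfolding bip_def by (intro sum.cong refl) (subst ip_commute, simp)

lemma bip_self: "bip f f = hs (\<rho> f)"
  by (simp add: bip_def hs_def)

text \<open>Faithfulness enters here: norm zero forces \<open>\<rho> f = \<rho> 0\<close>.\<close>

lemma bip_self_pos: assumes "f \<in> b" "f \<noteq> 0" shows "bip f f > 0"
proof -
  have "hs (\<rho> f) \<noteq> 0"
  proof
    assume "hs (\<rho> f) = 0"
    then have "\<rho> f = \<rho> 0" using hs_eq_0D[OF _ rho_lin[OF assms(1)]] by (auto simp: rho_0)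
    then show False using rho_inj assms real_vector.subspace_0[OF b_subspace] by (auto dest: inj_onD)
  qed
  then show ?thesis using hs_nonneg[of "\<rho> f"] by (simp add: bip_self)
qed

lemma bip_sum:
  assumes "finite I" "\<And>i. i \<in> I \<Longrightarrow> g i \<in> b" "f \<in> b"
  shows "bip f (\<Sum>i\<in>I. u i *\<^sub>R g i) = (\<Sum>i\<in>I. u i * bip f (g i))"
  using assms
proof induction
  case empty
  have "bip f 0 = 0" by (simp add: bip_def rho_0)
  then show ?case by (simp only: sum.empty)
next
  case (insert a I)
  have ga: "g a \<in> b" and s: "(\<Sum>i\<in>I. u i *\<^sub>R g i) \<in> b"
    using insert.prems by (auto intro: b_sum)
  show ?case
    using bip_add[OF insert.prems(2) real_vector.subspace_scale[OF b_subspace ga] s] insert.IH insert.prems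
    unfolding sum.insert[OF insert.hyps] by (simp only: bip_scale[OF insert.prems(2) ga] insert_iff simp_thms)
qed

lemma bip_bracket_right:
  assumes "f \<in> b" "g \<in> b" "h \<in> b"
  shows "bip h (bracket f g) =
    Re (\<i> / complex_of_real hbar * (tr (\<rho> h \<circ> \<rho> f \<circ> \<rho> g) - tr (\<rho> h \<circ> \<rho> g \<circ> \<rho> f)))"
  unfolding bip_def tr_def Re_sum[symmetric] sum_subtractf[symmetric] sum_distrib_left
  by (intro arg_cong[of _ _ Re] sum.cong refl)
    (simp add: rho_bracket assms ip_scale ip_diff symD(2)[OF rho_sym] linD[OF rho_lin])

text \<open>Invariance of the trace form: both sides are differences of traces of triple products,
  which cyclicity of the trace matches with opposite signs.\<close>

lemma bip_antisym:
  assumes "f \<in> b" "g \<in> b" "h \<in> b"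
  shows "bip h (bracket f g) = - bip g (bracket f h)"
proof -
  note l = rho_lin[OF assms(1)] rho_lin[OF assms(2)] rho_lin[OF assms(3)]
  have "tr (\<rho> h \<circ> \<rho> f \<circ> \<rho> g) = tr (\<rho> g \<circ> \<rho> h \<circ> \<rho> f)"
    using tr_commute[OF lin_comp[OF l(3,1)] l(2)] by (simp add: comp_assoc)
  moreover have "tr (\<rho> h \<circ> \<rho> g \<circ> \<rho> f) = tr (\<rho> g \<circ> \<rho> f \<circ> \<rho> h)"
    using tr_commute[OF l(3) lin_comp[OF l(2,1)]] by (simp add: comp_assoc)
  ultimately show ?thesis
    by (simp only: bip_bracket_right assms) (simp add: algebra_simps)
qed

end

locale observables_rep_onb = observables_rep cscale ip B A \<omega> b hbar \<rho>
  for cscale :: "complex \<Rightarrow> 'h::ab_group_add \<Rightarrow> 'h" and ip and B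
    and A :: "('m::{t2_space,second_countable_topology}, 'e::euclidean_space) chart set"
    and \<omega> and b and hbar and \<rho> +
  fixes E :: "('m \<Rightarrow> real) set"
  assumes finite_E: "finite E" and span_E: "Real_Vector_Spaces.span E = b"
    and orthonormal_E: "x \<in> E \<Longrightarrow> y \<in> E \<Longrightarrow> bip x y = (if x = y then 1 else 0)"

lemma (in observables_rep) ex_b_onb: "\<exists>E. observables_rep_onb cscale ip B A \<omega> b hbar \<rho> E"
proof -
  obtain S where S: "finite S" "Real_Vector_Spaces.span S = b" using fin_dim_b by (auto simp: finite_dimensional_def)
  have "\<exists>E. finite E \<and> Real_Vector_Spaces.span E = b \<and> (\<forall>x\<in>E. \<forall>y\<in>E. bip x y = (if x = y then 1 else 0))"
  proof (rule real_vector.ex_orthonormal_basis[OF b_subspace _ _ _ _ S])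
    show "\<exists>c. bip (c *\<^sub>R x) (c *\<^sub>R x) = 1" if x: "x \<in> b" "x \<noteq> 0" for x
    proof -
      define c where "c = inverse (sqrt (bip x x))"
      have "bip (c *\<^sub>R x) (c *\<^sub>R x) = c * (c * bip x x)"
        using x real_vector.subspace_scale[OF b_subspace x(1), of c]
        by (simp add: bip_scale bip_sym[of "c *\<^sub>R x" x])
      also have "\<dots> = 1"
        using bip_self_pos[OF x] by (simp add: c_def field_simps flip: real_sqrt_mult)
      finally show ?thesis by blast
    qed
    show "bip y x = 0" if "bip x y = 0" for x y using that bip_sym[of y x] by simp
  qed (auto simp: bip_add bip_scale)
  then obtain E where "finite E" "Real_Vector_Spaces.span E = b" "\<forall>x\<in>E. \<forall>y\<in>E. bip x y = (if x = y then 1 else 0)"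
    by auto
  then have "observables_rep_onb cscale ip B A \<omega> b hbar \<rho> E" by unfold_locales auto
  then show ?thesis by blast
qed

section \<open>The Hermitian moment map and its evolution along the flows\<close>

context observables_rep_onb
begin

lemma E_b: "E \<subseteq> b"
  using span_E real_vector.span_superset[of E] by simp

lemma E_in_b: "e \<in> E \<Longrightarrow> e \<in> b"
  using E_b by auto

lemma E_expansion: "f \<in> b \<Longrightarrow> (\<Sum>e\<in>E. bip e f *\<^sub>R e) = f"
  by (rule real_vector.orthonormal_expansion[OF b_subspace bip_add bip_scale finite_E span_E orthonormal_E])

lemma sum_fun_apply: "(\<Sum>e\<in>S. u e *\<^sub>R e) m = (\<Sum>e\<in>S. u e * (e m :: real))"
  by (induction S rule: infinite_finite_induct) (auto simp: plus_fun_def zero_fun_def scaleR_fun_def)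

lemma E_expansion_apply: assumes "f \<in> b" shows "f m = (\<Sum>e\<in>E. bip e f * e m)"
  using fun_cong[OF E_expansion[OF assms], of m] by (simp add: sum_fun_apply)

text \<open>Parseval for the basis \<open>E\<close>, which is orthonormal for \<open>bip\<close>:
  pairing the combination with \<open>i \<in> E\<close> recovers the coefficient
  \<open>u i\<close>.\<close>

lemma hs_rho_sum: "hs (\<rho> (\<Sum>e\<in>E. u e *\<^sub>R e)) = (\<Sum>e\<in>E. (u e)\<^sup>2)"
proof -
  have J: "(\<Sum>e\<in>E. u e *\<^sub>R e) \<in> b" by (rule b_sum) (rule E_in_b)
  have "bip (\<Sum>e\<in>E. u e *\<^sub>R e) i = u i" if "i \<in> E" for i
  proof -
    have "bip i (\<Sum>e\<in>E. u e *\<^sub>R e) = (\<Sum>e\<in>E. u e * (if i = e then 1 else 0))"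
      using that E_in_b by (simp add: bip_sum[of E "\<lambda>e. e"] finite_E orthonormal_E)
    also have "\<dots> = u i" using that finite_E by (simp add: if_distrib cong: if_cong)
    finally show ?thesis by (simp add: bip_sym)
  qed
  then have "(\<Sum>i\<in>E. u i * bip (\<Sum>e\<in>E. u e *\<^sub>R e) i) = (\<Sum>e\<in>E. (u e)\<^sup>2)"
    by (intro sum.cong refl) (simp only: power2_eq_square)
  then show ?thesis
    unfolding bip_self[symmetric] using bip_sum[of E "\<lambda>e. e", OF finite_E E_in_b J] by metis
qed

text \<open>The moment map, carried to Hermitian operators by the inner product of \<open>b\<close> and \<open>\<rho>\<close>.\<close>

definition J :: "'m \<Rightarrow> 'm \<Rightarrow> real" where "J m = (\<Sum>e\<in>E. e m *\<^sub>R e)"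
definition H :: "'m \<Rightarrow> 'h \<Rightarrow> 'h" where "H m = \<rho> (J m)"

lemma J_b: "J m \<in> b" unfolding J_def by (rule b_sum) (rule E_in_b)

lemma H_sym: "sym (H m)" and H_lin: "lin (H m)"
  unfolding H_def using J_b rho_sym rho_lin by auto

lemma H_apply: "H m x = (\<Sum>e\<in>E. cscale (complex_of_real (e m)) (\<rho> e x))"
  unfolding H_def J_def by (rule rho_sum[of E "\<lambda>e. e", OF finite_E E_in_b])

text \<open>Links the two settings: the coordinate distance of \<open>isometric_flows\<close> is the
  Hilbert-Schmidt distance between the operators.\<close>

lemma hs_H_diff: "hs (\<lambda>x. H m x - H m' x) = (\<Sum>e\<in>E. (e m - e m')\<^sup>2)"
proof -
  have "(\<lambda>x. H m x - H m' x) = \<rho> (\<Sum>e\<in>E. (e m - e m') *\<^sub>R e)"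
    by (simp add: fun_eq_iff rho_sum[of E "\<lambda>e. e", OF finite_E E_in_b] H_apply sum_subtractf[symmetric]
      scale_left_diff_distrib)
  then show ?thesis by (simp add: hs_rho_sum)
qed

lemma ip_H: "ip x (H m y) = (\<Sum>e\<in>E. complex_of_real (e m) * ip (\<rho> e x) y)"
  by (simp add: H_apply ip_sum ip_scale symD(2)[OF rho_sym] E_in_b)

text \<open>The skew-adjoint generator of the conjugation by which the flow of \<open>f\<close> acts
  on \<open>H\<close>. Its sign compensates the one from \<open>bip_antisym\<close>.\<close>

definition K :: "('m \<Rightarrow> real) \<Rightarrow> 'h \<Rightarrow> 'h"
  where "K f x = cscale (- (\<i> / complex_of_real hbar)) (\<rho> f x)"

lemma K_lin: "f \<in> b \<Longrightarrow> lin (K f)"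
  by (rule linI) (simp_all add: K_def linD[OF rho_lin] scale_right_distrib scale_right_diff_distrib mult.commute)

lemma bracket_E: assumes "f \<in> b" "i \<in> E"
  shows "bracket f i m = (\<Sum>j\<in>E. bip j (bracket f i) * j m)"
  by (rule E_expansion_apply[OF b_bracket[OF assms(1) E_in_b[OF assms(2)]]])

text \<open>A Lax equation: the left side is the derivative of \<open>H\<close> along the flow of
  \<open>f\<close>. Expand each \<open>bracket f i\<close> in \<open>E\<close>, let
  \<open>bip_antisym\<close> turn its coefficient at \<open>j\<close> into minus that of
  \<open>bracket f j\<close> at \<open>i\<close>, and sum over \<open>i\<close> first to recover
  \<open>\<rho> (bracket f j)\<close>.\<close>

lemma H_commutator:
  assumes f: "f \<in> b"
  shows "(\<Sum>i\<in>E. cscale (complex_of_real (bracket f i m)) (\<rho> i x)) = K f (H m x) - H m (K f x)"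
proof -
  have "(\<Sum>i\<in>E. cscale (complex_of_real (bracket f i m)) (\<rho> i x)) =
    (\<Sum>i\<in>E. \<Sum>j\<in>E. cscale (- complex_of_real (j m)) (cscale (complex_of_real (bip i (bracket f j))) (\<rho> i x)))"
  proof (intro sum.cong refl)
    fix i assume i: "i \<in> E"
    have "complex_of_real (bip j (bracket f i) * j m) =
        - complex_of_real (j m) * complex_of_real (bip i (bracket f j))" if "j \<in> E" for j
      by (simp add: bip_antisym[OF f E_in_b[OF i] E_in_b[OF that]])
    then have "complex_of_real (bracket f i m) =
        (\<Sum>j\<in>E. - complex_of_real (j m) * complex_of_real (bip i (bracket f j)))"
      by (subst bracket_E[OF f i], subst of_real_sum) (intro sum.cong refl)
    then show "cscale (complex_of_real (bracket f i m)) (\<rho> i x) =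
        (\<Sum>j\<in>E. cscale (- complex_of_real (j m)) (cscale (complex_of_real (bip i (bracket f j))) (\<rho> i x)))"
      by (simp only: scale_sum_left scale_scale)
  qed
  also have "\<dots> = (\<Sum>j\<in>E. cscale (- complex_of_real (j m)) (\<Sum>i\<in>E. cscale (complex_of_real (bip i (bracket f j))) (\<rho> i x)))"
    by (subst sum.swap) (simp only: scale_sum_right)
  also have "\<dots> = (\<Sum>j\<in>E. cscale (- complex_of_real (j m)) (\<rho> (bracket f j) x))"
    by (intro sum.cong refl)
      (simp only: rho_sum[of E "\<lambda>e. e", OF finite_E E_in_b, symmetric] E_expansion b_bracket f E_in_b)
  also have "\<dots> = (\<Sum>j\<in>E. cscale (complex_of_real (j m)) (K f (\<rho> j x)) - cscale (complex_of_real (j m)) (\<rho> j (K f x)))"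
    by (intro sum.cong refl)
      (simp add: rho_bracket f E_in_b K_def linD[OF rho_lin] scale_right_diff_distrib mult.commute)
  also have "\<dots> = K f (H m x) - H m (K f x)"
    by (simp add: H_apply linD[OF K_lin[OF f]] sum_subtractf)
  finally show ?thesis .
qed

text \<open>Stated for matrix coefficients, as \<open>'h\<close> carries no topology. In the product
  rule for \<open>H (\<gamma> t)\<close> times its \<open>k\<close>-th power, the terms with
  \<open>K f\<close> between the factors cancel. The induction needs all \<open>x\<close>, since
  \<open>\<rho> i\<close> is moved onto \<open>x\<close>.\<close>

lemma H_funpow_derivative:
  assumes f: "f \<in> b" and \<gamma>: "integral_curve A (hamiltonian_vf A \<omega> f) \<gamma>"
  shows "((\<lambda>t. ip x ((H (\<gamma> t) ^^ k) y)) has_vector_derivative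
    ip x (K f ((H (\<gamma> t) ^^ k) y) - (H (\<gamma> t) ^^ k) (K f y))) (at t)"
proof (induction k arbitrary: x)
  case (Suc k)
  define z where "z = (H (\<gamma> t) ^^ k) y"
  define z' where "z' = K f z - (H (\<gamma> t) ^^ k) (K f y)"
  have "((\<lambda>t. complex_of_real (i (\<gamma> t))) has_vector_derivative complex_of_real (bracket f i (\<gamma> t))) (at t)"
    if "i \<in> E" for i
    using integral_curve_poisson_bracket[OF atlas \<gamma> b_smooth[OF E_in_b[OF that]], of t]
    by (rule has_vector_derivative_of_real)
  moreover have "((\<lambda>t. ip (\<rho> i x) ((H (\<gamma> t) ^^ k) y)) has_vector_derivative ip (\<rho> i x) z') (at t)" for i
    using Suc[of "\<rho> i x"] by (simp add: z_def z'_def)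
  ultimately have "((\<lambda>t. \<Sum>i\<in>E. complex_of_real (i (\<gamma> t)) * ip (\<rho> i x) ((H (\<gamma> t) ^^ k) y)) has_vector_derivative
      (\<Sum>i\<in>E. complex_of_real (i (\<gamma> t)) * ip (\<rho> i x) z' + complex_of_real (bracket f i (\<gamma> t)) * ip (\<rho> i x) z)) (at t)"
    unfolding z_def by (intro has_vector_derivative_sum has_vector_derivative_mult)
  moreover have "(\<Sum>i\<in>E. complex_of_real (bracket f i (\<gamma> t)) * ip (\<rho> i x) z) = ip x (K f (H (\<gamma> t) z) - H (\<gamma> t) (K f z))"
    by (simp add: H_commutator[OF f, symmetric] ip_sum ip_scale symD(2)[OF rho_sym] E_in_b)
  moreover have "H (\<gamma> t) z' = H (\<gamma> t) (K f z) - (H (\<gamma> t) ^^ Suc k) (K f y)"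
    by (simp add: z'_def linD[OF H_lin])
  ultimately show ?case
    by (simp add: ip_H[symmetric] sum.distrib z_def ip_diff)
qed simp

text \<open>The derivative is the trace of a commutator.\<close>

lemma tr_H_funpow_derivative:
  assumes f: "f \<in> b" and \<gamma>: "integral_curve A (hamiltonian_vf A \<omega> f) \<gamma>"
  shows "((\<lambda>t. tr (H (\<gamma> t) ^^ k)) has_vector_derivative 0) (at t)"
proof -
  have "((\<lambda>t. tr (H (\<gamma> t) ^^ k)) has_vector_derivative
      (\<Sum>e\<in>B. ip e (K f ((H (\<gamma> t) ^^ k) e) - (H (\<gamma> t) ^^ k) (K f e)))) (at t)"
    unfolding tr_def by (intro has_vector_derivative_sum H_funpow_derivative[OF f \<gamma>])
  moreover have "(\<Sum>e\<in>B. ip e (K f ((H (\<gamma> t) ^^ k) e) - (H (\<gamma> t) ^^ k) (K f e))) = 0"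
    using tr_commute[OF K_lin[OF f] lin_funpow[OF H_lin[of "\<gamma> t"]], of k]
    by (simp add: tr_def ip_diff sum_subtractf)
  ultimately show ?thesis by simp
qed

lemma H_funpow_differentiable:
  assumes c: "c \<in> A" "x \<in> snd c ` fst c"
  shows "(\<lambda>p. ip y ((H (chart_inv c p) ^^ k) z)) differentiable (at x)"
proof (induction k arbitrary: y)
  case (Suc k)
  have "(\<lambda>p. complex_of_real (i (chart_inv c p))) differentiable (at x)" if "i \<in> E" for i
  proof -
    have "(\<lambda>p. i (chart_inv c p)) differentiable (at x)"
      using smooth_functions_differentiable[OF b_smooth[OF E_in_b[OF that]] c] by (simp add: comp_def)
    then show ?thesis unfolding differentiable_def using has_derivative_of_real by blast
  qed
  then show ?case
    by (simp add: ip_H finite_E) (intro differentiable_sum ballI differentiable_mult finite_E Suc)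
qed simp

section \<open>Constant power traces, the commutation criterion and compactness\<close>

lemma tr_H_constant: "tr (H m ^^ k) = tr (H m' ^^ k)"
proof (rule first_integral_constant[OF atlas connected_M b_transitive b_complete])
  fix c x assume "c \<in> A" "x \<in> snd c ` fst c"
  then show "((\<lambda>m. tr (H m ^^ k)) \<circ> chart_inv c) differentiable (at x)"
    unfolding tr_def comp_def using finite_B by (intro differentiable_sum ballI H_funpow_differentiable)
qed (rule tr_H_funpow_derivative)

text \<open>With \<open>tr_H_constant\<close> this places all coordinate vectors on one sphere,
  which gives the bound for \<open>isometric_flows\<close>.\<close>

lemma sum_squares_E: "(\<Sum>e\<in>E. (e m)\<^sup>2) = Re (tr (H m ^^ 2))"
proof -
  have "(\<Sum>e\<in>E. (e m)\<^sup>2) = hs (H m)" by (simp add: H_def J_def hs_rho_sum)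
  also have "\<dots> = Re (tr (H m ^^ 2))"
    by (simp add: hs_def tr_def symD(2)[OF H_sym] numeral_2_eq_2)
  finally show ?thesis .
qed

lemma E_separating: assumes "\<And>e. e \<in> E \<Longrightarrow> e m = e m'" shows "m = m'"
proof (rule ccontr)
  assume "m \<noteq> m'"
  then obtain f where f: "f \<in> b" "f m \<noteq> f m'" using b_separating by (auto simp: separating_def)
  have "(\<Sum>e\<in>E. bip e f * e m) = (\<Sum>e\<in>E. bip e f * e m')"
    by (intro sum.cong refl) (simp only: assms)
  then show False using f E_expansion_apply[OF f(1)] by metis
qed

text \<open>The premise says that \<open>{f, J m}\<close> is orthogonal to \<open>J m'\<close> for
  all \<open>f\<close>; by invariance, \<open>f\<close> is then orthogonal to
  \<open>{J m, J m'}\<close>. For \<open>f = {J m, J m'}\<close> this gives \<open>f\<close> norm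
  zero, and \<open>\<rho> f\<close> is a nonzero multiple of the commutator of \<open>H m\<close>
  and \<open>H m'\<close>.\<close>

lemma H_commute_if:
  assumes "\<And>f. f \<in> b \<Longrightarrow> (\<Sum>e\<in>E. \<Sum>j\<in>E. bip j (bracket f e) * e m * j m') = 0"
  shows "H m (H m' x) = H m' (H m x)"
proof -
  define f where "f = bracket (J m) (J m')"
  define F where "F = \<rho> f"
  have f: "f \<in> b" unfolding f_def by (intro b_bracket J_b)
  have lF: "lin F" unfolding F_def by (rule rho_lin[OF f])
  have Fx: "F x = cscale (\<i> / complex_of_real hbar) (H m (H m' x) - H m' (H m x))" for x
    unfolding F_def f_def H_def by (rule rho_bracket[OF J_b J_b])
  \<comment> \<open>This is \<open>{f, J m}\<close>, written as a combination of brackets with basis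
    elements so that the premise and \<open>rho_sum\<close> apply to it.\<close>
  define w where "w = (\<Sum>e\<in>E. e m *\<^sub>R bracket f e)"
  have fE: "bracket f e \<in> b" if "e \<in> E" for e by (intro b_bracket f E_in_b that)
  have w: "w \<in> b" unfolding w_def by (rule b_sum) (rule fE)
  have rw: "\<rho> w x = cscale (\<i> / complex_of_real hbar) (F (H m x) - H m (F x))" for x
  proof -
    have "\<rho> w x = (\<Sum>e\<in>E. cscale (complex_of_real (e m))
        (cscale (\<i> / complex_of_real hbar) (F (\<rho> e x) - \<rho> e (F x))))"
      unfolding w_def F_def
      by (simp only: rho_sum[OF finite_E fE]) (intro sum.cong refl, simp add: rho_bracket[OF f E_in_b])
    also have "\<dots> = (\<Sum>e\<in>E. cscale (\<i> / complex_of_real hbar)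
        (F (cscale (complex_of_real (e m)) (\<rho> e x)) - cscale (complex_of_real (e m)) (\<rho> e (F x))))"
      by (simp add: linD[OF lF] scale_right_diff_distrib mult.commute)
    finally show ?thesis
      by (simp only: scale_sum_right[symmetric] sum_subtractf linD(5)[OF lF, symmetric] H_apply[symmetric])
  qed
  have "bip (J m') w = (\<Sum>j\<in>E. j m' * bip w j)"
    by (subst bip_sym) (simp only: J_def bip_sum[of E "\<lambda>e. e", OF finite_E E_in_b w])
  also have "\<dots> = (\<Sum>j\<in>E. j m' * (\<Sum>e\<in>E. e m * bip j (bracket f e)))"
    by (intro sum.cong refl) (subst bip_sym, simp only: w_def bip_sum[OF finite_E fE E_in_b])
  also have "\<dots> = (\<Sum>e\<in>E. \<Sum>j\<in>E. bip j (bracket f e) * e m * j m')"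
    by (subst sum.swap) (simp add: sum_distrib_left mult_ac)
  also have "\<dots> = 0" by (rule assms[OF f])
  finally have "bip (J m') w = 0" .
  moreover have "bip (J m') w = Re (\<i> / complex_of_real hbar * (tr (H m' \<circ> (F \<circ> H m)) - tr ((H m' \<circ> H m) \<circ> F)))"
    unfolding bip_def tr_def Re_sum[symmetric] sum_subtractf[symmetric] sum_distrib_left H_def[symmetric]
    by (intro arg_cong[of _ _ Re] sum.cong refl)
      (simp add: rw ip_scale ip_diff symD(2)[OF H_sym] linD[OF H_lin])
  moreover have "tr (H m' \<circ> (F \<circ> H m)) = tr (F \<circ> (H m \<circ> H m'))"
    using tr_commute[OF H_lin lin_comp[OF lF H_lin]] by (simp add: comp_assoc)
  moreover have "tr ((H m' \<circ> H m) \<circ> F) = tr (F \<circ> (H m' \<circ> H m))"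
    by (rule tr_commute[OF lin_comp[OF H_lin H_lin] lF])
  \<comment> \<open>After the cyclic moves \<open>F\<close> stands in front of the scaled commutator
    of \<open>H m\<close> and \<open>H m'\<close>, which is \<open>F\<close> again.\<close>
  moreover have "\<i> / complex_of_real hbar * (tr (F \<circ> (H m \<circ> H m')) - tr (F \<circ> (H m' \<circ> H m))) = tr (F \<circ> F)"
    unfolding tr_def sum_subtractf[symmetric] sum_distrib_left
  proof (intro sum.cong refl)
    fix e
    have "F (F e) = cscale (\<i> / complex_of_real hbar) (F (H m (H m' e)) - F (H m' (H m e)))"
      by (subst (2) Fx) (simp only: linD[OF lF])
    then show "\<i> / complex_of_real hbar * (ip e ((F \<circ> (H m \<circ> H m')) e) - ip e ((F \<circ> (H m' \<circ> H m)) e)) = ip e ((F \<circ> F) e)"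
      by (simp only: ip_scale ip_diff comp_apply)
  qed
  moreover have "Re (tr (F \<circ> F)) = hs F"
    by (simp add: hs_def tr_def F_def symD(2)[OF rho_sym[OF f]])
  ultimately have "hs F = 0" by metis
  then have "F x = 0" using lF by (rule hs_eq_0D)
  then show ?thesis using Fx[of x] hbar_pos by simp
qed

lemma compact_M: "compact (UNIV :: 'm set)"
proof -
  \<comment> \<open>\<open>undefined\<close> is just a base point: by \<open>tr_H_constant\<close>
    every \<open>H m\<close> has the same power traces as \<open>H undefined\<close>.\<close>
  obtain \<delta> where \<delta>: "\<delta> > 0" "\<And>S S'. sym S \<Longrightarrow> sym S' \<Longrightarrow> (\<And>k. tr (S ^^ k) = tr (H undefined ^^ k)) \<Longrightarrow>
      (\<And>k. tr (S' ^^ k) = tr (H undefined ^^ k)) \<Longrightarrow> (\<And>x. S (S' x) = S' (S x)) \<Longrightarrow>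
      hs (\<lambda>x. S x - S' x) < \<delta> \<Longrightarrow> S = S'"
    using isospectral_commuting_gap[OF H_sym[of undefined]] by meson
  \<comment> \<open>The matrix of \<open>f\<close> consists of the coefficients of
    \<open>bracket f e\<close> in the basis \<open>E\<close>. The gap is
    \<open>sqrt \<delta>\<close>, as \<open>hs\<close> is a squared norm and \<open>L2_set\<close>
    is not.\<close>
  interpret isometric_flows E b "\<lambda>f. {\<gamma>. integral_curve A (hamiltonian_vf A \<omega> f) \<gamma>}"
    "\<lambda>f e j. bip j (bracket f e)" "Re (tr (H undefined ^^ 2))" "sqrt \<delta>"
  proof
    show "finite E" by (rule finite_E)
    show "continuous_on UNIV e" if "e \<in> E" for e
      by (rule smooth_functions_continuous[OF atlas b_smooth[OF E_in_b[OF that]]])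
    show "m = m'" if "\<And>e. e \<in> E \<Longrightarrow> e m = e m'" for m m' using that by (rule E_separating)
    show "(\<Sum>e\<in>E. (e m)\<^sup>2) \<le> Re (tr (H undefined ^^ 2))" for m
      unfolding sum_squares_E using tr_H_constant[of 2 m undefined] by simp
    show "\<exists>\<gamma>\<in>{\<gamma>. integral_curve A (hamiltonian_vf A \<omega> f) \<gamma>}. \<gamma> 0 = m" if "f \<in> b" for f m
      using b_complete that unfolding complete_fields_def complete_vector_field_def by blast
    show "((\<lambda>t. e (\<gamma> t)) has_real_derivative (\<Sum>j\<in>E. bip j (bracket f e) * j (\<gamma> t))) (at t)"
      if "f \<in> b" "\<gamma> \<in> {\<gamma>. integral_curve A (hamiltonian_vf A \<omega> f) \<gamma>}" "e \<in> E" for f \<gamma> e t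
      using integral_curve_poisson_bracket[OF atlas _ b_smooth[OF E_in_b[OF that(3)]], of \<omega> f \<gamma> t] that(2)
      by (simp only: bracket_E[OF that(1,3)] mem_Collect_eq)
    show "bip j (bracket f e) = - bip e (bracket f j)" if "f \<in> b" "e \<in> E" "j \<in> E" for f e j
      by (rule bip_antisym[OF that(1) E_in_b[OF that(2)] E_in_b[OF that(3)]])
    show "sqrt \<delta> > 0" using \<delta>(1) by simp
    show "m = m'" if c: "\<And>f. f \<in> b \<Longrightarrow> (\<Sum>e\<in>E. \<Sum>j\<in>E. bip j (bracket f e) * e m * j m') = 0"
      and d: "L2_set (\<lambda>e. e m - e m') E < sqrt \<delta>" for m m'
    proof (rule E_separating)
      fix e assume e: "e \<in> E"
      have "hs (\<lambda>x. H m x - H m' x) < \<delta>" using d by (simp add: hs_H_diff L2_set_def)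
      then have "H m = H m'"
        by (intro \<delta>(2) H_sym tr_H_constant H_commute_if[OF c])
      then have "(\<Sum>e\<in>E. (e m - e m')\<^sup>2) = 0" unfolding hs_H_diff[symmetric] by (simp add: hs_def)
      then show "e m = e m'" using e finite_E by (simp add: sum_nonneg_eq_0_iff)
    qed
    show "\<exists>V C. open V \<and> m \<in> V \<and> V \<subseteq> C \<and> compact C \<and> C \<subseteq> U" if "open U" "m \<in> U" for U and m :: 'm
      by (rule atlas_locally_compact[OF atlas that])
    show "connected (UNIV :: 'm set)" by (rule connected_M)
    show "(\<lambda>t. \<gamma> (s + t)) \<in> {\<gamma>. integral_curve A (hamiltonian_vf A \<omega> f) \<gamma>}"
      if "\<gamma> \<in> {\<gamma>. integral_curve A (hamiltonian_vf A \<omega> f) \<gamma>}" for \<gamma> f s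
      using that integral_curve_shift by blast
    show "continuous_on UNIV \<gamma>" if "\<gamma> \<in> {\<gamma>. integral_curve A (hamiltonian_vf A \<omega> f) \<gamma>}" for \<gamma> f
      using that by (simp add: integral_curve_def)
  qed
  show ?thesis by (rule compact_UNIV)
qed

end

section \<open>Nonexistence of faithful representations in the noncompact case\<close>

theorem theorem25:
  fixes A :: "('m::{t2_space,second_countable_topology}, 'e::euclidean_space) chart set"
    and \<omega> :: "('m, 'e) two_tensor"
    and b :: "('m \<Rightarrow> real) set"
    and hbar :: real
    and cscale :: "complex \<Rightarrow> 'h::ab_group_add \<Rightarrow> 'h"
    and ip :: "'h \<Rightarrow> 'h \<Rightarrow> complex"
  assumes "symplectic_manifold A \<omega>"
    and "connected (UNIV :: 'm set)"
    and "\<not> compact (UNIV :: 'm set)"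
    and "hbar > 0"
    and "basic_algebra A \<omega> b"
    and "finite_dimensional b"
    and "finite_dim_complex_hilbert cscale ip"
  shows "\<not> (\<exists>\<rho>. faithful_symmetric_representation A \<omega> hbar b cscale ip \<rho>)"
proof
  assume "\<exists>\<rho>. faithful_symmetric_representation A \<omega> hbar b cscale ip \<rho>"
  then obtain \<rho> where \<rho>: "faithful_symmetric_representation A \<omega> hbar b cscale ip \<rho>" ..
  obtain B where "complex_onb cscale ip B"
    using finite_dim_complex_hilbert.ex_complex_onb[OF assms(7)] ..
  then interpret complex_onb cscale ip B .
  interpret observables_rep cscale ip B A \<omega> b hbar \<rho>
    using assms \<rho> by unfold_locales (auto simp: symplectic_manifold_def basic_algebra_def)
  obtain E where "observables_rep_onb cscale ip B A \<omega> b hbar \<rho> E" using ex_b_onb ..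
  then interpret observables_rep_onb cscale ip B A \<omega> b hbar \<rho> E .
  show False using compact_M assms(3) by contradiction
qed

end
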